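(* Let $d\geqslant 1$ be an integer, $T>0$, $0<\sigma\leqslant 1$, $s\geqslant 0$, $\psi\in L^1(0,T)$ with $\psi\not\equiv 0$ in $L^1(0,T)$, and $h\in L^2(\mathbb{R}^d)$. For each $\varepsilon>0$ let $\widetilde\psi=\widetilde\psi_\varepsilon\in L^1(0,T)$ and $\widetilde h=\widetilde h_\varepsilon\in L^2(\mathbb{R}^d)$ satisfy $$\|h-\widetilde h\|_{L^2(\mathbb{R}^d)}+\|\psi-\widetilde\psi\|_{L^1(0,T)}\leqslant\varepsilon .$$ Assume that the equation $H_\psi(|\mathbf{z}|^{2\sigma})\,\widehat f(\mathbf{z})=\widehat h(\mathbf{z})$ (a.e. $\mathbf{z}\in\mathbb{R}^d$) admits a unique solution $f\in H^s(\mathbb{R}^d)$. If there exists a function $\alpha=\alpha(\varepsilon)>0$ such that $$\lim_{\varepsilon\to0^+}\alpha(\varepsilon)=0,\qquad \lim_{\varepsilon\to0^+}\frac{\varepsilon}{[\alpha(\varepsilon)]^{1+\frac{s}{2\sigma}}}=0,$$ then $$\lim_{\varepsilon\to0^+}\|f-f_{\alpha(\varepsilon),\widetilde\psi,\widetilde h}\|_{H^s(\mathbb{R}^d)}=0 .$$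
   Context: The Fourier transform on $L^2(\mathbb{R}^d)$ is $\mathcal{F}(f)(\mathbf{z})=\widehat f(\mathbf{z})=(2\pi)^{-d/2}\int_{\mathbb{R}^d}f(\mathbf{x})e^{-i\mathbf{x}\cdot\mathbf{z}}\,d\mathbf{x}$. For $s\geqslant0$, $H^s(\mathbb{R}^d)$ is the space of $\theta\in L^2(\mathbb{R}^d)$ with $\|\theta\|_{H^s(\mathbb{R}^d)}^2:=\int_{\mathbb{R}^d}(1+|\mathbf{z}|^2)^s|\widehat\theta(\mathbf{z})|^2d\mathbf{z}<\infty$. For $\vartheta\in L^1(0,T)$, $$H_\vartheta(\nu)=\int_0^T e^{-(T-s)\nu}(T-s)\vartheta(s)\,ds,\qquad \nu\geqslant 0 .$$ For $\alpha>0$, $\vartheta\in L^1(0,T)$ and $g\in L^2(\mathbb{R}^d)$, the truncated regularized solution is $$f_{\alpha,\vartheta,g}:=\mathcal{F}^{-1}\left(\frac{\widehat g}{H_\vartheta(|\mathbf{z}|^{2\sigma})}\,\chi_{\{\mathbf{z}\in\mathbb{R}^d:\,|H_\vartheta(|\mathbf{z}|^{2\sigma})|>\alpha\}}\right),$$ where $\chi_\Omega$ is the characteristic function of $\Omega$ and the function in parentheses is taken to be $0$ where the characteristic function vanishes. *)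

theory Defs
  imports "HOL-Analysis.Analysis"
begin

text \<open>
  Elements of Lebesgue spaces are represented by Borel functions, and two representatives
  are identified when they agree almost everywhere. All functions are complex valued.
\<close>

definition L2 :: "('a::euclidean_space \<Rightarrow> complex) set" where
  "L2 = {f. f \<in> borel_measurable lborel \<and> integrable lborel (\<lambda>x. (cmod (f x))\<^sup>2)}"

definition L2_norm :: "('a::euclidean_space \<Rightarrow> complex) \<Rightarrow> real" where
  "L2_norm f = sqrt (LINT x|lborel. (cmod (f x))\<^sup>2)"

definition L1 :: "real \<Rightarrow> (real \<Rightarrow> complex) set" where
  "L1 T = {\<theta>. set_integrable lborel {0<..<T} \<theta>}"

definition L1_norm :: "real \<Rightarrow> (real \<Rightarrow> complex) \<Rightarrow> real" where
  "L1_norm T \<theta> = (LINT t:{0<..<T}|lborel. cmod (\<theta> t))"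

definition fourier_integral :: "('a::euclidean_space \<Rightarrow> complex) \<Rightarrow> 'a \<Rightarrow> complex" where
  "fourier_integral f z =
     of_real ((2 * pi) powr (- real DIM('a) / 2)) *
       (LINT x|lborel. f x * exp (- (\<i> * of_real (x \<bullet> z))))"

text \<open>
  For square-integrable \<open>f\<close> the integral above need not converge; the Fourier transform is
  the limit in \<open>L2\<close> of the transforms of the restrictions of \<open>f\<close> to the balls of radius \<open>n\<close>,
  which are integrable. The convergence is stated with the nonnegative integral because the
  Bochner integral of a non-integrable function is 0.
\<close>

definition is_fourier ::
  "('a::euclidean_space \<Rightarrow> complex) \<Rightarrow> ('a \<Rightarrow> complex) \<Rightarrow> bool" where
  "is_fourier f g \<longleftrightarrow> g \<in> L2 \<and>
     (\<lambda>n. \<integral>\<^sup>+ z. ennreal ((cmod (fourier_integral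
              (\<lambda>x. indicator (cball 0 (real n)) x * f x) z - g z))\<^sup>2) \<partial>lborel)
       \<longlonglongrightarrow> 0"

text \<open>The choice operator only selects a representative of an almost-everywhere class.\<close>

definition fourier :: "('a::euclidean_space \<Rightarrow> complex) \<Rightarrow> 'a \<Rightarrow> complex" where
  "fourier f = (SOME g. is_fourier f g)"

definition fourier_inv :: "('a::euclidean_space \<Rightarrow> complex) \<Rightarrow> 'a \<Rightarrow> complex" where
  "fourier_inv g = (SOME f. f \<in> L2 \<and> (AE z in lborel. fourier f z = g z))"

definition Sobolev :: "real \<Rightarrow> ('a::euclidean_space \<Rightarrow> complex) set" where
  "Sobolev s = {\<theta> \<in> L2.
     integrable lborel (\<lambda>z. (1 + (norm z)\<^sup>2) powr s * (cmod (fourier \<theta> z))\<^sup>2)}"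

text \<open>
  The norm takes the value \<open>\<infinity>\<close> outside the Sobolev space, so that a limit 0 entails
  membership eventually.
\<close>

definition Sobolev_norm :: "real \<Rightarrow> ('a::euclidean_space \<Rightarrow> complex) \<Rightarrow> ennreal" where
  "Sobolev_norm s \<theta> =
     (if \<theta> \<in> Sobolev s
      then ennreal (sqrt (LINT z|lborel. (1 + (norm z)\<^sup>2) powr s * (cmod (fourier \<theta> z))\<^sup>2))
      else \<infinity>)"

definition H :: "real \<Rightarrow> (real \<Rightarrow> complex) \<Rightarrow> real \<Rightarrow> complex" where
  "H T \<theta> \<nu> = (LINT s:{0<..<T}|lborel. of_real (exp (- (T - s) * \<nu>) * (T - s)) * \<theta> s)"

definition is_solution ::
  "real \<Rightarrow> real \<Rightarrow> (real \<Rightarrow> complex) \<Rightarrow> ('a::euclidean_space \<Rightarrow> complex) \<Rightarrow>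
     ('a \<Rightarrow> complex) \<Rightarrow> bool" where
  "is_solution T \<sigma> \<psi> h f \<longleftrightarrow>
     (AE z in lborel. H T \<psi> (norm z powr (2 * \<sigma>)) * fourier f z = fourier h z)"

definition regularized ::
  "real \<Rightarrow> real \<Rightarrow> real \<Rightarrow> (real \<Rightarrow> complex) \<Rightarrow> ('a::euclidean_space \<Rightarrow> complex) \<Rightarrow>
     'a \<Rightarrow> complex" where
  "regularized T \<sigma> \<alpha> \<theta> g = fourier_inv (\<lambda>z.
     if cmod (H T \<theta> (norm z powr (2 * \<sigma>))) > \<alpha>
     then fourier g z / H T \<theta> (norm z powr (2 * \<sigma>)) else 0)"

end

theory Submission
  imports Defs "HOL-Probability.Characteristic_Functions"
begin

text \<open>
  The Fourier transform turns the equation into multiplication by the symbol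
  \<open>H(\<bar>z\<bar> powr (2 * \<sigma>))\<close>, and the regularized solution divides by the perturbed symbol \<open>H'\<close> on the
  frequencies where \<open>\<bar>H'\<bar> > \<alpha>\<close>. Write \<open>f^\<close> for the transform of \<open>f\<close>. There the error is
  \<open>(f^ (H' - H) + (h^ - h'^)) / H'\<close>, elsewhere it is \<open>f^\<close>, so there are three terms to estimate in
  the weighted norm.

  The bound \<open>(1 + \<nu>) \<bar>H(\<nu>)\<bar> \<le> (T + 1) \<parallel>\<psi>\<parallel>\<close> (lemma \<open>H_decay\<close>) has two consequences. Applied to
  \<open>\<psi> - \<psi>'\<close> it gives \<open>\<bar>H - H'\<bar> \<le> (T + 1) \<epsilon>\<close>, so the term with \<open>f^\<close> is at most a multiple of
  \<open>\<epsilon> / \<alpha>\<close> times the Sobolev norm of \<open>f\<close>. Applied to \<open>\<psi>'\<close> it bounds the retained frequencies, where the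
  Sobolev weight is then at most a multiple of \<open>\<alpha> powr (- s / (2 * \<sigma>))\<close>; so the term with the noise in
  \<open>h\<close> is at most a multiple of \<open>\<epsilon> / \<alpha> powr (1 + s / (2 * \<sigma>))\<close>. The discarded frequencies satisfy
  \<open>\<bar>H\<bar> \<le> \<alpha> + (T + 1) \<epsilon>\<close>. As \<open>\<epsilon>\<close> tends to 0 these sets shrink to the zero set of the symbol, and the
  contribution of \<open>f^\<close> over them tends to 0 by dominated convergence, provided that the zero set is
  null. This last fact is read off from the uniqueness of the solution
  (\<open>unique_solution_symbol_nonzero\<close>): a function whose transform is supported on the zeros of
  the symbol could be added to \<open>f\<close>. The estimates are collected in \<open>regularization_error\<close>.

  The argument needs a Fourier transform on \<open>L2\<close> that exists, is linear and bounded up to a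
  constant, and is onto. The identity behind all of it is the multiplication formula,
  \<open>\<integral> f^ g = \<integral> f g^\<close> for integrable \<open>f\<close> and \<open>g\<close>. With a modulated Gaussian in place of \<open>g\<close> it shows
  that transforming twice, with a Gaussian factor in between, amounts to convolution with a heat
  kernel. This gives the bound on the energy (\<open>fourier_integral_energy_le\<close>), hence existence, and in
  the limit the inversion theorem (\<open>fourier_inversion\<close>), hence surjectivity. Inversion is proved
  weakly, so that the heat kernel has to be compared with the identity only on bounded
  continuous test functions.
\<close>

section \<open>Square-integrable functions\<close>

text \<open>
  The squared norm of \<open>L2\<close>, with value \<open>\<infinity>\<close> outside the space, so that inequalities and limits
  can be stated without integrability conditions. For this square the triangle inequality
  costs a factor 2, which affects neither finiteness nor convergence to 0.
\<close>

definition energy :: "('a::euclidean_space \<Rightarrow> complex) \<Rightarrow> ennreal" where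
  "energy f = (\<integral>\<^sup>+ x. ennreal ((cmod (f x))\<^sup>2) \<partial>lborel)"

lemma L2_iff_energy: "f \<in> L2 \<longleftrightarrow> f \<in> borel_measurable borel \<and> energy f < \<infinity>"
  unfolding L2_def energy_def integrable_iff_bounded by auto

lemma energy_eq_integral:
  assumes "f \<in> L2"
  shows "energy f = ennreal (LINT x|lborel. (cmod (f x))\<^sup>2)"
  using assms unfolding energy_def L2_def by (intro nn_integral_eq_integral) auto

lemma energy_eq_L2_norm:
  assumes "f \<in> L2"
  shows "energy f = ennreal ((L2_norm f)\<^sup>2)"
  using assms by (simp add: energy_eq_integral L2_norm_def)

lemma cmod_add_sq_le: "(cmod (a + b))\<^sup>2 \<le> 2 * (cmod a)\<^sup>2 + 2 * (cmod b)\<^sup>2"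
proof -
  have "(cmod (a + b))\<^sup>2 \<le> (cmod a + cmod b)\<^sup>2"
    by (intro power_mono norm_triangle_ineq) auto
  also have "\<dots> \<le> 2 * (cmod a)\<^sup>2 + 2 * (cmod b)\<^sup>2"
    using sum_squares_bound[of "cmod a" "cmod b"] by (simp add: power2_sum)
  finally show ?thesis .
qed

lemma energy_add_le:
  assumes [measurable]: "f \<in> borel_measurable borel" "g \<in> borel_measurable borel"
  shows "energy (\<lambda>x. f x + g x) \<le> 2 * energy f + 2 * energy g"
proof -
  have "energy (\<lambda>x. f x + g x) \<le>
      (\<integral>\<^sup>+ x. 2 * ennreal ((cmod (f x))\<^sup>2) + 2 * ennreal ((cmod (g x))\<^sup>2) \<partial>lborel)"
    unfolding energy_def
  proof (intro nn_integral_mono)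
    fix x
    show "ennreal ((cmod (f x + g x))\<^sup>2) \<le>
        2 * ennreal ((cmod (f x))\<^sup>2) + 2 * ennreal ((cmod (g x))\<^sup>2)"
      using ennreal_leI[OF cmod_add_sq_le[of "f x" "g x"]]
      by (simp add: ennreal_mult'')
  qed
  also have "\<dots> = 2 * energy f + 2 * energy g"
    unfolding energy_def by (simp add: nn_integral_add nn_integral_cmult)
  finally show ?thesis .
qed

lemma energy_cong_AE: "AE x in lborel. f x = g x \<Longrightarrow> energy f = energy g"
  unfolding energy_def by (intro nn_integral_cong_AE) auto

lemma energy_minus: "energy (\<lambda>x. - f x) = energy f"
  by (simp add: energy_def)

lemma energy_diff_commute: "energy (\<lambda>x. f x - g x) = energy (\<lambda>x. g x - f x)"
  by (simp add: energy_def norm_minus_commute)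

lemma energy_diff_le:
  assumes [measurable]: "f \<in> borel_measurable borel" "g \<in> borel_measurable borel"
  shows "energy (\<lambda>x. f x - g x) \<le> 2 * energy f + 2 * energy g"
  using energy_add_le[of f "\<lambda>x. - g x"] by (simp add: energy_minus)

lemma energy_triangle:
  assumes [measurable]: "f \<in> borel_measurable borel" "g \<in> borel_measurable borel"
    "h \<in> borel_measurable borel"
  shows "energy (\<lambda>x. f x - h x) \<le> 2 * energy (\<lambda>x. f x - g x) + 2 * energy (\<lambda>x. g x - h x)"
  using energy_add_le[of "\<lambda>x. f x - g x" "\<lambda>x. g x - h x"] by simp

lemma energy_eq_0_iff:
  assumes [measurable]: "f \<in> borel_measurable borel"
  shows "energy f = 0 \<longleftrightarrow> (AE x in lborel. f x = 0)"
  unfolding energy_def by (subst nn_integral_0_iff_AE) auto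

lemma L2_diff:
  assumes "f \<in> L2" "g \<in> L2"
  shows "(\<lambda>x. f x - g x) \<in> L2"
proof -
  have "2 * energy f + 2 * energy g < \<infinity>"
    using assms by (simp add: L2_iff_energy ennreal_mult_less_top)
  then show ?thesis
    using assms order_le_less_trans[OF energy_diff_le[of f g]] by (auto simp: L2_iff_energy)
qed

lemma energy_mono: "(\<And>x. cmod (f x) \<le> cmod (g x)) \<Longrightarrow> energy f \<le> energy g"
  unfolding energy_def by (intro nn_integral_mono ennreal_leI power_mono) auto

lemma L2_dominated:
  assumes "g \<in> L2" "f \<in> borel_measurable borel" "\<And>x. cmod (f x) \<le> cmod (g x)"
  shows "f \<in> L2"
  using assms order_le_less_trans[OF energy_mono[of f g]] by (auto simp: L2_iff_energy)

lemma integrable_L2_mult: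
  assumes "f \<in> L2" "g \<in> L2"
  shows "integrable lborel (\<lambda>x. f x * g x)"
proof (rule Bochner_Integration.integrable_bound)
  show "integrable lborel (\<lambda>x. (cmod (f x))\<^sup>2 + (cmod (g x))\<^sup>2)"
    using assms by (auto simp: L2_def)
  show "(\<lambda>x. f x * g x) \<in> borel_measurable lborel"
    using assms by (auto simp: L2_def)
  have "cmod (f x) * cmod (g x) \<le> (cmod (f x))\<^sup>2 + (cmod (g x))\<^sup>2" for x
    using sum_squares_bound[of "cmod (f x)" "cmod (g x)"] mult_nonneg_nonneg[OF norm_ge_zero norm_ge_zero, of "f x" "g x"]
    by (simp only: mult.assoc)
  then show "AE x in lborel. norm (f x * g x) \<le> norm ((cmod (f x))\<^sup>2 + (cmod (g x))\<^sup>2)"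
    by (auto simp: norm_mult)
qed

lemma energy_tendsto_0_dominated:
  assumes [measurable]: "\<And>n. F n \<in> borel_measurable borel" and "g \<in> L2"
    and "\<And>n x. cmod (F n x) \<le> cmod (g x)" and lim: "AE x in lborel. (\<lambda>n. F n x) \<longlonglongrightarrow> 0"
  shows "(\<lambda>n. energy (F n)) \<longlonglongrightarrow> 0"
proof -
  have [measurable]: "g \<in> borel_measurable borel" using assms(2) by (simp add: L2_def)
  have "(\<lambda>n. \<integral>\<^sup>+ x. ennreal ((cmod (F n x))\<^sup>2) \<partial>lborel) \<longlonglongrightarrow> (\<integral>\<^sup>+ (x::'a). 0 \<partial>lborel)"
  proof (rule nn_integral_dominated_convergence[where w="\<lambda>x. ennreal ((cmod (g x))\<^sup>2)"])
    show "(\<integral>\<^sup>+ x. ennreal ((cmod (g x))\<^sup>2) \<partial>lborel) < \<infinity>"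
      using assms(2) by (simp add: L2_iff_energy energy_def)
    show "AE x in lborel. (\<lambda>n. ennreal ((cmod (F n x))\<^sup>2)) \<longlonglongrightarrow> 0"
      using lim
    proof eventually_elim
      fix x assume "(\<lambda>n. F n x) \<longlonglongrightarrow> 0"
      then have "(\<lambda>n. (cmod (F n x))\<^sup>2) \<longlonglongrightarrow> (cmod 0)\<^sup>2"
        by (intro tendsto_intros)
      then show "(\<lambda>n. ennreal ((cmod (F n x))\<^sup>2)) \<longlonglongrightarrow> 0"
        using tendsto_ennrealI by fastforce
    qed
  qed (auto intro!: AE_I2 ennreal_leI power_mono assms)
  then show ?thesis by (simp add: energy_def)
qed

lemma energy_tendsto_unique:
  assumes [measurable]: "\<And>n. F n \<in> borel_measurable borel"
      "f \<in> borel_measurable borel" "g \<in> borel_measurable borel"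
    and "(\<lambda>n. energy (\<lambda>x. F n x - f x)) \<longlonglongrightarrow> 0" "(\<lambda>n. energy (\<lambda>x. F n x - g x)) \<longlonglongrightarrow> 0"
  shows "AE x in lborel. f x = g x"
proof -
  have "(\<lambda>n. 2 * energy (\<lambda>x. F n x - f x) + 2 * energy (\<lambda>x. F n x - g x)) \<longlonglongrightarrow> 2 * 0 + 2 * 0"
    by (intro tendsto_intros ennreal_tendsto_cmult assms) auto
  moreover have "energy (\<lambda>x. f x - g x) \<le> 2 * energy (\<lambda>x. F n x - f x) + 2 * energy (\<lambda>x. F n x - g x)" for n
    using energy_triangle[of f "F n" g] by (simp add: energy_diff_commute[of f])
  ultimately have "energy (\<lambda>x. f x - g x) \<le> 2 * 0 + 2 * 0"
    by (intro LIMSEQ_le_const) auto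
  then show ?thesis by (simp add: energy_eq_0_iff)
qed

text \<open>
  The functions through which \<^const>\<open>is_fourier\<close> defines the transform: they are integrable and
  converge to \<open>f\<close> in \<open>L2\<close>.
\<close>

abbreviation truncate :: "nat \<Rightarrow> ('a::euclidean_space \<Rightarrow> complex) \<Rightarrow> 'a \<Rightarrow> complex" where
  "truncate n f \<equiv> (\<lambda>x. indicator (cball 0 (real n)) x * f x)"

lemma indicator_cball_L2: "(indicator (cball 0 r) :: 'a::euclidean_space \<Rightarrow> complex) \<in> L2"
proof -
  have *: "(\<lambda>x. ennreal ((cmod (indicator (cball 0 r) x))\<^sup>2)) = (indicator (cball (0::'a) r))"
    by (auto simp: indicator_def fun_eq_iff)
  show ?thesis
    unfolding L2_iff_energy energy_def * 
    using emeasure_lborel_cball_finite[of "0::'a" r] by (simp add: borel_measurable_indicator)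
qed

lemma truncate_L2: "f \<in> L2 \<Longrightarrow> truncate n f \<in> L2"
  by (rule L2_dominated[of f]) (auto simp: indicator_def L2_def)

lemma truncate_integrable: "f \<in> L2 \<Longrightarrow> integrable lborel (truncate n f)"
  by (intro integrable_L2_mult indicator_cball_L2)

lemma truncate_measurable [measurable]:
  "f \<in> borel_measurable borel \<Longrightarrow> truncate n f \<in> borel_measurable borel"
  by (intro borel_measurable_times borel_measurable_indicator) auto

lemma truncate_tendsto:
  assumes "f \<in> L2"
  shows "(\<lambda>n. energy (\<lambda>x. truncate n f x - f x)) \<longlonglongrightarrow> 0"
proof (rule energy_tendsto_0_dominated[OF _ assms])
  have [measurable]: "f \<in> borel_measurable borel" using assms by (simp add: L2_def)
  show "(\<lambda>x. truncate n f x - f x) \<in> borel_measurable borel" for n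
    by (intro borel_measurable_diff truncate_measurable) fact+
  show "cmod (truncate n f x - f x) \<le> cmod (f x)" for n x
    by (auto simp: indicator_def)
  show "AE x in lborel. (\<lambda>n. truncate n f x - f x) \<longlonglongrightarrow> 0"
  proof (intro AE_I2 tendsto_eventually)
    fix x :: 'a
    obtain N where "norm x \<le> real N" using real_arch_simple by blast
    then show "\<forall>\<^sub>F n in sequentially. truncate n f x - f x = 0"
      by (auto simp: eventually_sequentially indicator_def intro!: exI[of _ N])
  qed
qed

section \<open>Gaussian integrals\<close>

definition gauss :: "real \<Rightarrow> 'a::euclidean_space \<Rightarrow> real" where
  "gauss r x = exp (- (r\<^sup>2 * (norm x)\<^sup>2 / 2))"

lemma gauss_pos [simp]: "0 < gauss r x" and gauss_nonneg [simp]: "0 \<le> gauss r x"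
  and gauss_le_1: "gauss r x \<le> 1" and gauss_minus [simp]: "gauss r (- x) = gauss r x"
  by (auto simp: gauss_def)

lemma gauss_measurable [measurable]: "gauss r \<in> borel_measurable borel"
  unfolding gauss_def by measurable

lemma gauss_diff_commute: "gauss r (x - y) = gauss r (y - x)"
  by (simp add: gauss_def norm_minus_commute)

lemma gauss_scale: "gauss r (c *\<^sub>R x) = gauss (r * c) x"
  by (simp add: gauss_def power_mult_distrib)

lemma gauss_prod: "gauss 1 x = (\<Prod>b\<in>Basis. exp (- (x \<bullet> b)\<^sup>2 / 2))"
proof -
  have "(norm x)\<^sup>2 = (\<Sum>b\<in>Basis. (x \<bullet> b)\<^sup>2)"
    by (subst euclidean_inner[of x x, folded power2_norm_eq_inner]) (simp add: power2_eq_square)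
  then show ?thesis
    by (simp add: gauss_def exp_sum[symmetric] sum_negf sum_divide_distrib)
qed

lemma lborel_integral_affine:
  fixes f :: "'a::euclidean_space \<Rightarrow> 'b::{banach, second_countable_topology}"
  assumes [measurable]: "f \<in> borel_measurable borel" and c: "c \<noteq> 0"
  shows "(LINT x|lborel. f x) = \<bar>c\<bar> ^ DIM('a) *\<^sub>R (LINT x|lborel. f (t + c *\<^sub>R x))"
  by (subst lborel_affine[OF c, of t])
     (subst integral_density, auto simp: integral_distr)

lemma lborel_integrable_affine:
  fixes f :: "'a::euclidean_space \<Rightarrow> 'b::{banach, second_countable_topology}"
  assumes f: "integrable lborel f" and c: "c \<noteq> 0"
  shows "integrable lborel (\<lambda>x. f (t + c *\<^sub>R x))"
proof -
  have [measurable]: "f \<in> borel_measurable borel" using f by auto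
  have "integrable (density (distr lborel borel (\<lambda>x. t + c *\<^sub>R x)) (\<lambda>_. \<bar>c\<bar>^DIM('a))) f"
    using f lborel_affine[OF c, of t] by simp
  then have "integrable lborel (\<lambda>x. \<bar>c\<bar>^DIM('a) *\<^sub>R f (t + c *\<^sub>R x))"
    by (subst (asm) integrable_density) (auto simp: integrable_distr_eq)
  from integrable_scaleR_right[OF this, of "inverse (\<bar>c\<bar> ^ DIM('a))"]
  show ?thesis using c by simp
qed

lemma lborel_nn_integral_affine:
  fixes f :: "'a::euclidean_space \<Rightarrow> ennreal"
  assumes [measurable]: "f \<in> borel_measurable borel" and c: "c \<noteq> 0"
  shows "(\<integral>\<^sup>+x. f x \<partial>lborel) = ennreal (\<bar>c\<bar> ^ DIM('a)) * (\<integral>\<^sup>+x. f (t + c *\<^sub>R x) \<partial>lborel)"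
  by (subst lborel_affine[OF c, of t])
     (subst nn_integral_density, auto simp: nn_integral_distr nn_integral_cmult)

text \<open>
  This is the characteristic function of the standard normal distribution. The case of several
  variables is a product of copies of it, since both the Gaussian and the character factor over
  the coordinates.
\<close>

lemma gauss_fourier_1d:
  "has_bochner_integral lborel (\<lambda>x::real. of_real (exp (- x\<^sup>2 / 2)) * exp (- (\<i> * of_real (x * u))))
     (of_real (sqrt (2 * pi) * exp (- u\<^sup>2 / 2)))"
proof -
  interpret prob_space std_normal_distribution by (rule prob_space_normal_density) simp
  let ?g = "\<lambda>x. exp (- (\<i> * of_real (x * u)))"
  have int: "integrable std_normal_distribution ?g"
    by (rule integrable_const_bound[of _ 1]) auto
  then have "integrable lborel (\<lambda>x. std_normal_density x *\<^sub>R ?g x)"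
    by (subst (asm) integrable_density) auto
  moreover have "(LINT x|lborel. std_normal_density x *\<^sub>R ?g x) = char std_normal_distribution (- u)"
    unfolding char_def by (subst integral_density) (auto simp: mult.commute)
  ultimately have "has_bochner_integral lborel (\<lambda>x. std_normal_density x *\<^sub>R ?g x)
      (of_real (exp (- u\<^sup>2 / 2)))"
    by (simp add: has_bochner_integral_iff char_std_normal_distribution)
  from has_bochner_integral_scaleR_right[OF this, of "sqrt (2 * pi)"]
  show ?thesis
    by (simp add: std_normal_density_def scaleR_conv_of_real)
qed

lemma lborel_integral_prod:
  fixes f :: "'a::euclidean_space \<Rightarrow> real \<Rightarrow> complex"
  assumes f: "\<And>b. b \<in> Basis \<Longrightarrow> has_bochner_integral lborel (f b) (I b)"
  shows "has_bochner_integral lborel (\<lambda>x. \<Prod>b\<in>Basis. f b (x \<bullet> b)) (\<Prod>b\<in>Basis. I b)"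
proof -
  interpret product_sigma_finite "\<lambda>_::'a. lborel :: real measure" ..
  have [measurable]: "b \<in> Basis \<Longrightarrow> f b \<in> borel_measurable borel" for b
    using f[of b] by (auto simp: has_bochner_integral_iff)
  let ?P = "\<lambda>y. \<Prod>b\<in>Basis. f b (y b)"
  have eq: "(\<lambda>y. \<Prod>b\<in>Basis. f b ((\<Sum>c\<in>Basis. y c *\<^sub>R c) \<bullet> b)) = ?P"
    by (intro ext prod.cong) auto
  have "integrable (\<Pi>\<^sub>M b\<in>Basis. lborel) ?P"
    using f by (intro product_integrable_prod) (auto simp: has_bochner_integral_iff)
  moreover have "(LINT y|(\<Pi>\<^sub>M b\<in>Basis. lborel). ?P y) = (\<Prod>b\<in>Basis. I b)"
    using f by (subst product_integral_prod) (auto simp: has_bochner_integral_iff)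
  ultimately show ?thesis
    by (subst lborel_eq) (simp add: has_bochner_integral_iff integrable_distr_eq integral_distr eq)
qed

lemma gauss_fourier_std:
  fixes u :: "'a::euclidean_space"
  shows "has_bochner_integral lborel (\<lambda>x. of_real (gauss 1 x) * exp (- (\<i> * of_real (x \<bullet> u))))
    (of_real ((2 * pi) powr (real DIM('a) / 2) * gauss 1 u))"
proof -
  have "has_bochner_integral lborel
      (\<lambda>x. \<Prod>b\<in>Basis. of_real (exp (- (x \<bullet> b)\<^sup>2 / 2)) * exp (- (\<i> * of_real ((x \<bullet> b) * (u \<bullet> b)))))
      (\<Prod>b\<in>Basis. of_real (sqrt (2 * pi) * exp (- (u \<bullet> b)\<^sup>2 / 2)))"
    by (rule lborel_integral_prod) (rule gauss_fourier_1d)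
  moreover have "exp (- (\<i> * of_real (x \<bullet> u))) =
      (\<Prod>b\<in>Basis. exp (- (\<i> * of_real ((x \<bullet> b) * (u \<bullet> b)))))" for x
    by (simp add: exp_sum[symmetric] euclidean_inner[of x u] sum_negf sum_distrib_left)
  then have "(\<Prod>b\<in>Basis. of_real (exp (- (x \<bullet> b)\<^sup>2 / 2)) * exp (- (\<i> * of_real ((x \<bullet> b) * (u \<bullet> b)))))
     = of_real (gauss 1 x) * exp (- (\<i> * of_real (x \<bullet> u)))" for x :: 'a
    by (simp add: prod.distrib gauss_prod)
  moreover have "sqrt (2 * pi) ^ DIM('a) = (2 * pi) powr (real DIM('a) / 2)"
    by (simp add: powr_half_sqrt[symmetric] powr_realpow[symmetric] powr_powr del: powr_realpow)
  then have "(\<Prod>b\<in>(Basis::'a set). complex_of_real (sqrt (2 * pi) * exp (- (u \<bullet> b)\<^sup>2 / 2)))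
     = of_real ((2 * pi) powr (real DIM('a) / 2) * gauss 1 u)"
    by (simp add: prod.distrib gauss_prod flip: of_real_power)
  ultimately show ?thesis by simp
qed

lemma gauss_fourier:
  fixes u :: "'a::euclidean_space"
  assumes r: "r > 0"
  shows "has_bochner_integral lborel (\<lambda>x. of_real (gauss r x) * exp (- (\<i> * of_real (x \<bullet> u))))
    (of_real ((2 * pi) powr (real DIM('a) / 2) / r ^ DIM('a) * gauss (1 / r) u))"
proof -
  let ?f = "\<lambda>x. of_real (gauss 1 x) * exp (- (\<i> * of_real (x \<bullet> ((1 / r) *\<^sub>R u))))"
  have f: "has_bochner_integral lborel ?f
      (of_real ((2 * pi) powr (real DIM('a) / 2) * gauss 1 ((1 / r) *\<^sub>R u)))"
    by (rule gauss_fourier_std)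
  then have [measurable]: "?f \<in> borel_measurable borel"
    by (auto simp: has_bochner_integral_iff)
  have eq: "?f (0 + r *\<^sub>R x) = of_real (gauss r x) * exp (- (\<i> * of_real (x \<bullet> u)))" for x
    using r by (simp add: gauss_scale)
  have "integrable lborel (\<lambda>x. ?f (0 + r *\<^sub>R x))"
    using f r by (intro lborel_integrable_affine) (auto simp: has_bochner_integral_iff)
  moreover have "(LINT x|lborel. ?f x) = r ^ DIM('a) *\<^sub>R (LINT x|lborel. ?f (0 + r *\<^sub>R x))"
    using r by (subst lborel_integral_affine[of ?f r 0]) auto
  moreover have "(LINT x|lborel. ?f x)
      = of_real ((2 * pi) powr (real DIM('a) / 2) * gauss 1 ((1 / r) *\<^sub>R u))"
    using f by (simp add: has_bochner_integral_iff)
  ultimately show ?thesis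
    using r unfolding eq
    by (simp add: has_bochner_integral_iff gauss_scale scaleR_conv_of_real field_simps)
qed

lemma gauss_integrable: "r > 0 \<Longrightarrow> integrable lborel (\<lambda>x::'a::euclidean_space. complex_of_real (gauss r x))"
  using gauss_fourier[of r "0::'a"] by (simp add: has_bochner_integral_iff)

section \<open>The Fourier integral of integrable functions\<close>

lemma cmod_exp_minus_i [simp]: "cmod (exp (- (\<i> * of_real a))) = 1"
  by (metis minus_mult_right norm_exp_i_times of_real_minus)

lemma kernel_measurable [measurable]:
  "(\<lambda>x::'a::euclidean_space. exp (- (\<i> * of_real (x \<bullet> z)))) \<in> borel_measurable borel"
  by (intro borel_measurable_continuous_onI continuous_intros)

lemma kernel_measurable_pair [measurable]:
  "(\<lambda>p::'a::euclidean_space \<times> 'a. exp (- (\<i> * of_real (fst p \<bullet> snd p))))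
     \<in> borel_measurable (borel \<Otimes>\<^sub>M borel)"
  unfolding borel_prod by (intro borel_measurable_continuous_onI continuous_intros)

lemma fourier_integral_measurable [measurable]:
  assumes [measurable]: "f \<in> borel_measurable borel"
  shows "fourier_integral f \<in> borel_measurable borel"
proof -
  have "(\<lambda>z. LINT x|lborel. f x * exp (- (\<i> * of_real (x \<bullet> z)))) \<in> borel_measurable borel"
  proof (rule lborel.borel_measurable_lebesgue_integral)
    have "(\<lambda>p. f (snd p) * exp (- (\<i> * of_real (snd p \<bullet> fst p)))) \<in> borel_measurable (borel \<Otimes>\<^sub>M lborel)"
      using kernel_measurable_pair[where 'a='a]
      by (subst inner_commute) measurable
    then show "(\<lambda>(z, x). f x * exp (- (\<i> * of_real (x \<bullet> z)))) \<in> borel_measurable (borel \<Otimes>\<^sub>M lborel)"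
      by (simp add: case_prod_beta')
  qed
  then show ?thesis
    unfolding fourier_integral_def by measurable
qed

lemma integrable_fourier_kernel:
  assumes "integrable lborel f"
  shows "integrable lborel (\<lambda>x. f x * exp (- (\<i> * of_real (x \<bullet> z))))"
proof (rule Bochner_Integration.integrable_bound[OF assms])
  have [measurable]: "f \<in> borel_measurable borel" using assms by auto
  show "(\<lambda>x. f x * exp (- (\<i> * of_real (x \<bullet> z)))) \<in> borel_measurable lborel"
    by measurable
qed (auto simp: norm_mult)

lemma fourier_integral_bound:
  fixes f :: "'a::euclidean_space \<Rightarrow> complex"
  shows "cmod (fourier_integral f z) \<le>
    (2 * pi) powr (- real DIM('a) / 2) * (LINT x|lborel. cmod (f x))"
proof -
  have "cmod (LINT x|lborel. f x * exp (- (\<i> * of_real (x \<bullet> z)))) \<le>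
      (LINT x|lborel. cmod (f x * exp (- (\<i> * of_real (x \<bullet> z)))))"
    by (rule integral_norm_bound)
  then show ?thesis
    by (simp add: fourier_integral_def norm_mult mult_left_mono)
qed

lemma fourier_integral_diff:
  assumes "integrable lborel f" "integrable lborel g"
  shows "fourier_integral (\<lambda>x. f x - g x) z = fourier_integral f z - fourier_integral g z"
  using assms[THEN integrable_fourier_kernel, of z]
  by (simp add: fourier_integral_def left_diff_distrib Bochner_Integration.integral_diff
      right_diff_distrib)

lemma fourier_integral_reflect:
  assumes [measurable]: "f \<in> borel_measurable borel"
  shows "fourier_integral (\<lambda>x. f (- x)) z = fourier_integral f (- z)"
  unfolding fourier_integral_def
  by (subst (2) lborel_integral_affine[where c="-1" and t=0]) auto

text \<open>
  Both sides are the double integral of \<open>f x * g z * exp (- i x z)\<close>. The convolution formula for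
  \<open>mollify\<close>, the bound on the energy and the symmetry of mollification all come from it.
\<close>

lemma multiplication_formula:
  fixes f g :: "'a::euclidean_space \<Rightarrow> complex"
  assumes f: "integrable lborel f" and g: "integrable lborel g"
  shows "(LINT z|lborel. fourier_integral f z * g z) = (LINT x|lborel. f x * fourier_integral g x)"
proof -
  have [measurable]: "f \<in> borel_measurable borel" "g \<in> borel_measurable borel"
    using f g by auto
  let ?F = "\<lambda>x z. f x * g z * exp (- (\<i> * of_real (x \<bullet> z)))"
  have "integrable (lborel \<Otimes>\<^sub>M lborel) (case_prod ?F)"
  proof (rule lborel_pair.Fubini_integrable)
    have "(\<lambda>p. f (fst p) * g (snd p) * exp (- (\<i> * of_real (fst p \<bullet> snd p))))
        \<in> borel_measurable (borel \<Otimes>\<^sub>M borel)"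
      using kernel_measurable_pair[where 'a='a] by measurable
    then show "case_prod ?F \<in> borel_measurable (lborel \<Otimes>\<^sub>M lborel)"
      by (simp add: case_prod_beta' cong: measurable_cong_sets)
    show "integrable lborel (\<lambda>x. LINT z|lborel. cmod (case (x, z) of (x, z) \<Rightarrow> ?F x z))"
      using f g by (simp add: norm_mult)
    show "AE x in lborel. integrable lborel (\<lambda>z. case (x, z) of (x, z) \<Rightarrow> ?F x z)"
      using integrable_fourier_kernel[OF g]
      by (auto simp: mult.assoc inner_commute)
  qed
  from lborel_pair.Fubini_integral[OF this]
  have swap: "(LINT z|lborel. LINT x|lborel. ?F x z) = (LINT x|lborel. LINT z|lborel. ?F x z)" .
  let ?c = "complex_of_real ((2 * pi) powr (- real DIM('a) / 2))"
  have "fourier_integral f z * g z = ?c * (LINT x|lborel. ?F x z)" for z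
  proof -
    have "(LINT x|lborel. ?F x z) = (LINT x|lborel. f x * exp (- (\<i> * of_real (x \<bullet> z)))) * g z"
      by (subst integral_mult_left_zero[symmetric]) (simp add: mult_ac)
    then show ?thesis by (simp only: fourier_integral_def mult.assoc)
  qed
  moreover have "f x * fourier_integral g x = ?c * (LINT z|lborel. ?F x z)" for x
  proof -
    have "(LINT z|lborel. ?F x z) = f x * (LINT z|lborel. g z * exp (- (\<i> * of_real (z \<bullet> x))))"
      by (subst integral_mult_right_zero[symmetric]) (simp add: mult_ac inner_commute)
    then show ?thesis by (simp only: fourier_integral_def mult.left_commute)
  qed
  ultimately show ?thesis
    using swap by (simp only: integral_mult_right_zero)
qed

text \<open>
  The Gaussian probability density of variance \<open>r\<^sup>2\<close> in every direction. It is the Fourier image of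
  \<open>gauss r\<close>, normalized so that \<open>mollify r\<close> becomes convolution with it.
\<close>

definition heat_kernel :: "real \<Rightarrow> 'a::euclidean_space \<Rightarrow> real" where
  "heat_kernel r y = (2 * pi) powr (- real DIM('a) / 2) / r ^ DIM('a) * gauss (1 / r) y"

lemma heat_kernel_nonneg: "0 < r \<Longrightarrow> 0 \<le> heat_kernel r y"
  by (simp add: heat_kernel_def)

lemma heat_kernel_measurable [measurable]: "heat_kernel r \<in> borel_measurable borel"
  unfolding heat_kernel_def by measurable

lemma heat_kernel_diff_commute: "heat_kernel r (x - y) = heat_kernel r (y - x)"
  by (simp add: heat_kernel_def gauss_diff_commute)

lemma heat_kernel_bounded: "0 < r \<Longrightarrow> heat_kernel r (y::'a::euclidean_space) \<le> (2 * pi) powr (- real DIM('a) / 2) / r ^ DIM('a)"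
  unfolding heat_kernel_def by (rule mult_left_le) (auto simp: gauss_le_1)

lemma norm_const_mult: "(2 * pi) powr (- real d / 2) * (2 * pi) powr (real d / 2) = 1"
  by (simp add: powr_add[symmetric])

lemma heat_kernel_integral:
  assumes r: "r > 0"
  shows "has_bochner_integral lborel (heat_kernel r) (1::real)"
proof -
  have "has_bochner_integral lborel (\<lambda>x::'a. complex_of_real (gauss (1 / r) x))
      (of_real ((2 * pi) powr (real DIM('a) / 2) * r ^ DIM('a)))"
    using gauss_fourier[of "1 / r" "0::'a"] r by (simp add: power_one_over gauss_def)
  from has_bochner_integral_Re[OF this]
  have "has_bochner_integral lborel (\<lambda>x::'a. gauss (1 / r) x)
      ((2 * pi) powr (real DIM('a) / 2) * r ^ DIM('a))" by simp
  from has_bochner_integral_mult_right[OF this, of "(2 * pi) powr (- real DIM('a) / 2) / r ^ DIM('a)"]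
  show ?thesis
    using r norm_const_mult[of "DIM('a)"] by (simp add: heat_kernel_def[abs_def] mult_ac)
qed

lemma heat_kernel_nn_integral:
  fixes x :: "'a::euclidean_space"
  assumes r: "r > 0"
  shows "(\<integral>\<^sup>+ y. ennreal (heat_kernel r (y - x)) \<partial>lborel) = 1"
proof -
  have "(\<integral>\<^sup>+ y. ennreal (heat_kernel r (y - x)) \<partial>lborel) = (\<integral>\<^sup>+ y. ennreal (heat_kernel r (y::'a)) \<partial>lborel)"
    by (subst lborel_nn_integral_affine[where c=1 and t=x]) auto
  also have "\<dots> = 1"
    using heat_kernel_integral[OF r, where 'a='a] r
    by (subst nn_integral_eq_integral) (auto simp: has_bochner_integral_iff heat_kernel_nonneg)
  finally show ?thesis .
qed

lemma fourier_integral_gauss_modulated: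
  fixes x y :: "'a::euclidean_space"
  assumes r: "r > 0"
  shows "integrable lborel (\<lambda>z. of_real (gauss r z) * exp (- (\<i> * of_real (z \<bullet> (- x)))))"
    and "of_real ((2 * pi) powr (- real DIM('a) / 2)) *
      fourier_integral (\<lambda>z. of_real (gauss r z) * exp (- (\<i> * of_real (z \<bullet> (- x))))) y
      = of_real (heat_kernel r (y - x))"
proof -
  show "integrable lborel (\<lambda>z. of_real (gauss r z) * exp (- (\<i> * of_real (z \<bullet> (- x)))))"
    by (rule integrable_fourier_kernel[OF gauss_integrable[OF r]])
  have *: "of_real (gauss r z) * exp (- (\<i> * of_real (z \<bullet> (- x)))) * exp (- (\<i> * of_real (z \<bullet> y)))
     = of_real (gauss r z) * exp (- (\<i> * of_real (z \<bullet> (y - x))))" for z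
    by (simp add: mult.assoc exp_add[symmetric] algebra_simps)
  have "fourier_integral (\<lambda>z. of_real (gauss r z) * exp (- (\<i> * of_real (z \<bullet> (- x))))) y
     = of_real ((2 * pi) powr (- real DIM('a) / 2)) *
        of_real ((2 * pi) powr (real DIM('a) / 2) / r ^ DIM('a) * gauss (1 / r) (y - x))"
    unfolding fourier_integral_def *
    using gauss_fourier[OF r, of "y - x"] by (simp add: has_bochner_integral_iff)
  also have "\<dots> = of_real (1 / r ^ DIM('a) * gauss (1 / r) (y - x))"
    using norm_const_mult[of "DIM('a)"]
    by (simp only: of_real_mult[symmetric] times_divide_eq_right mult.assoc[symmetric] times_divide_eq_left)
  finally show "of_real ((2 * pi) powr (- real DIM('a) / 2)) *
      fourier_integral (\<lambda>z. of_real (gauss r z) * exp (- (\<i> * of_real (z \<bullet> (- x))))) y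
      = of_real (heat_kernel r (y - x))"
    by (simp add: heat_kernel_def)
qed

text \<open>
  Transforming, reflecting and transforming again should give \<open>f\<close> back. The factor \<open>gauss r\<close> makes the
  outer integral converge absolutely; it tends to 1 as \<open>r\<close> tends to 0.
\<close>

definition mollify :: "real \<Rightarrow> ('a::euclidean_space \<Rightarrow> complex) \<Rightarrow> 'a \<Rightarrow> complex" where
  "mollify r f = fourier_integral (\<lambda>z. fourier_integral f (- z) * of_real (gauss r z))"

lemma integrable_fourier_integral_gauss:
  fixes f :: "'a::euclidean_space \<Rightarrow> complex"
  assumes f: "integrable lborel f" and r: "r > 0"
  shows "integrable lborel (\<lambda>z. fourier_integral f z * of_real (gauss r z))"
    and "integrable lborel (\<lambda>z. fourier_integral f (- z) * of_real (gauss r z))"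
proof -
  have [measurable]: "f \<in> borel_measurable borel" using f by auto
  let ?C = "(2 * pi) powr (- real DIM('a) / 2) * (LINT x|lborel. cmod (f x))"
  have C: "0 \<le> ?C" by simp
  have int: "integrable lborel (\<lambda>z::'a. ?C *\<^sub>R complex_of_real (gauss r z))"
    by (intro integrable_scaleR_right gauss_integrable r)
  have bound: "cmod (fourier_integral f w * of_real (gauss r z))
     \<le> cmod (?C *\<^sub>R complex_of_real (gauss r z))" for w z
    using fourier_integral_bound[of f w] C by (simp add: norm_mult mult_right_mono abs_mult del: mult_nonneg_nonneg)
  show "integrable lborel (\<lambda>z. fourier_integral f z * of_real (gauss r z))"
    by (rule Bochner_Integration.integrable_bound[OF int]) (measurable, rule AE_I2, rule bound)
  show "integrable lborel (\<lambda>z. fourier_integral f (- z) * of_real (gauss r z))"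
    by (rule Bochner_Integration.integrable_bound[OF int]) (measurable, rule AE_I2, rule bound)
qed

text \<open>
  The multiplication formula moves the transform from \<open>f\<close> to the modulated Gaussian, whose
  transform is a translate of the heat kernel.
\<close>

lemma mollify_eq_convolution:
  fixes f :: "'a::euclidean_space \<Rightarrow> complex"
  assumes f: "integrable lborel f" and r: "r > 0"
  shows "mollify r f x = (LINT y|lborel. f y * of_real (heat_kernel r (y - x)))"
proof -
  have [measurable]: "f \<in> borel_measurable borel" using f by auto
  let ?c = "complex_of_real ((2 * pi) powr (- real DIM('a) / 2))"
  let ?w = "\<lambda>z. of_real (gauss r z) * exp (- (\<i> * of_real (z \<bullet> (- x))))"
  have "mollify r f x = ?c * (LINT z|lborel. fourier_integral f z * ?w z)"
    unfolding mollify_def fourier_integral_def[of "\<lambda>z. fourier_integral f (- z) * _ z"]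
    by (subst lborel_integral_affine[where c="-1" and t=0]) (auto simp: mult.assoc)
  also have "(LINT z|lborel. fourier_integral f z * ?w z) = (LINT y|lborel. f y * fourier_integral ?w y)"
    by (rule multiplication_formula[OF f fourier_integral_gauss_modulated(1)[OF r]])
  also have "?c * \<dots> = (LINT y|lborel. f y * (?c * fourier_integral ?w y))"
    by (subst integral_mult_right_zero[symmetric]) (simp add: mult_ac)
  also have "\<dots> = (LINT y|lborel. f y * of_real (heat_kernel r (y - x)))"
    by (simp only: fourier_integral_gauss_modulated(2)[OF r])
  finally show ?thesis .
qed

lemma cmod_mollify_le:
  assumes f: "integrable lborel f" and r: "r > 0"
  shows "ennreal (cmod (mollify r f x)) \<le> (\<integral>\<^sup>+ y. ennreal (cmod (f y) * heat_kernel r (y - x)) \<partial>lborel)"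
proof -
  have [measurable]: "f \<in> borel_measurable borel" using f by auto
  have b: "\<exists>B. \<forall>y. heat_kernel r (y - x) \<le> B" using heat_kernel_bounded[OF r] by blast
  then obtain B where B: "\<And>y. heat_kernel r (y - x) \<le> B" by blast
  have "integrable lborel (\<lambda>y. f y * of_real (heat_kernel r (y - x)))"
  proof (rule Bochner_Integration.integrable_bound)
    show "integrable lborel (\<lambda>y. B *\<^sub>R f y)" using f by simp
    have "cmod (f y) * heat_kernel r (y - x) \<le> \<bar>B\<bar> * cmod (f y)" for y
      using mult_left_mono[OF order_trans[OF B[of y] abs_ge_self], of "cmod (f y)"] by (simp add: mult.commute)
    then show "AE y in lborel. norm (f y * of_real (heat_kernel r (y - x))) \<le> norm (B *\<^sub>R f y)"
      by (auto simp: norm_mult heat_kernel_nonneg[OF r])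
  qed measurable
  from integral_norm_bound_ennreal[OF this]
  show ?thesis
    by (simp add: mollify_eq_convolution[OF f r] norm_mult heat_kernel_nonneg[OF r])
qed

text \<open>
  By the multiplication formula the weighted integral of \<open>\<bar>fourier_integral f\<bar>\<^sup>2\<close> equals the integral
  of \<open>f\<close> against the conjugate of its convolution with the heat kernel. Since
  \<open>\<bar>f x\<bar> * \<bar>f y\<bar> \<le> \<bar>f x\<bar>\<^sup>2 / 2 + \<bar>f y\<bar>\<^sup>2 / 2\<close> and the kernel has mass 1 in either variable, this is at
  most the energy of \<open>f\<close>.
\<close>

lemma gauss_weighted_energy_le:
  fixes f :: "'a::euclidean_space \<Rightarrow> complex"
  assumes f: "integrable lborel f" and r: "r > 0"
  shows "(\<integral>\<^sup>+ z. ennreal ((cmod (fourier_integral f z))\<^sup>2 * gauss r z) \<partial>lborel) \<le> energy f"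
proof -
  have [measurable]: "f \<in> borel_measurable borel" using f by auto
  let ?F = "fourier_integral f"
  let ?w = "\<lambda>z. cnj (?F z) * of_real (gauss r z)"
  have w: "integrable lborel ?w"
    using integrable_cnj[OF integrable_fourier_integral_gauss(1)[OF f r]] by simp
  have Fw: "integrable lborel (\<lambda>z. ?F z * ?w z)"
  proof (rule Bochner_Integration.integrable_bound)
    let ?C = "(2 * pi) powr (- real DIM('a) / 2) * (LINT x|lborel. cmod (f x))"
    show "integrable lborel (\<lambda>z. ?C *\<^sub>R ?w z)" using w by simp
    show "AE z in lborel. norm (?F z * ?w z) \<le> norm (?C *\<^sub>R ?w z)"
      using fourier_integral_bound[of f] by (auto simp: norm_mult mult_right_mono intro!: AE_I2)
    have [measurable]: "(\<lambda>z. cnj (?F z)) \<in> borel_measurable borel"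
      by (rule measurable_compose[OF fourier_integral_measurable])
        (auto intro!: borel_measurable_continuous_onI continuous_intros)
    show "(\<lambda>z. ?F z * ?w z) \<in> borel_measurable lborel"
      by measurable
  qed
  have F_w: "fourier_integral ?w x = cnj (mollify r f x)" for x
  proof -
    have "mollify r f x = fourier_integral (\<lambda>z. ?F z * of_real (gauss r z)) (- x)"
      unfolding mollify_def
      using fourier_integral_reflect[of "\<lambda>z. ?F z * of_real (gauss r z)" x] by simp
    moreover have "cnj (exp (- (\<i> * of_real (z \<bullet> (- x))))) = exp (- (\<i> * of_real (z \<bullet> x)))" for z
      by (simp add: exp_cnj)
    ultimately show ?thesis
      by (simp only: fourier_integral_def[of ?w] fourier_integral_def[of "\<lambda>z. ?F z * of_real (gauss r z)"]
          complex_cnj_mult complex_cnj_complex_of_real Bochner_Integration.integral_cnj[symmetric])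
  qed
  have "(\<integral>\<^sup>+ z. ennreal ((cmod (?F z))\<^sup>2 * gauss r z) \<partial>lborel) = (\<integral>\<^sup>+ z. ennreal (Re (?F z * ?w z)) \<partial>lborel)"
    by (simp add: mult.assoc[symmetric] complex_norm_square[symmetric] del: of_real_power)
  also have "\<dots> = ennreal (LINT z|lborel. Re (?F z * ?w z))"
    using Fw by (intro nn_integral_eq_integral integrable_Re)
      (auto simp: mult.assoc[symmetric] complex_norm_square[symmetric] simp del: of_real_power)
  also have "\<dots> \<le> ennreal (cmod (LINT z|lborel. ?F z * ?w z))"
    by (simp only: integral_Re[OF Fw] ennreal_leI complex_Re_le_cmod)
  also have "(LINT z|lborel. ?F z * ?w z) = (LINT x|lborel. f x * cnj (mollify r f x))"
    by (simp add: multiplication_formula[OF f w] F_w)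
  also have "ennreal (cmod \<dots>) \<le> (\<integral>\<^sup>+ x. ennreal (cmod (f x * cnj (mollify r f x))) \<partial>lborel)"
  proof (cases "integrable lborel (\<lambda>x. f x * cnj (mollify r f x))")
    case True
    then show ?thesis by (rule integral_norm_bound_ennreal)
  qed (simp add: not_integrable_integral_eq)
  also have "\<dots> \<le> (\<integral>\<^sup>+ x. \<integral>\<^sup>+ y. ennreal (cmod (f x) * cmod (f y) * heat_kernel r (y - x)) \<partial>lborel \<partial>lborel)"
  proof (rule nn_integral_mono)
    fix x
    have "ennreal (cmod (f x)) * ennreal (cmod (mollify r f x)) \<le>
       ennreal (cmod (f x)) * (\<integral>\<^sup>+ y. ennreal (cmod (f y) * heat_kernel r (y - x)) \<partial>lborel)"
      by (intro mult_left_mono cmod_mollify_le f r) auto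
    also have "\<dots> = (\<integral>\<^sup>+ y. ennreal (cmod (f x) * cmod (f y) * heat_kernel r (y - x)) \<partial>lborel)"
      by (subst nn_integral_cmult[symmetric]) (auto simp: ennreal_mult mult.assoc heat_kernel_nonneg[OF r])
    finally show "ennreal (cmod (f x * cnj (mollify r f x))) \<le>
       (\<integral>\<^sup>+ y. ennreal (cmod (f x) * cmod (f y) * heat_kernel r (y - x)) \<partial>lborel)"
      by (simp add: norm_mult ennreal_mult)
  qed
  also have "\<dots> \<le> (\<integral>\<^sup>+ x. \<integral>\<^sup>+ y. ennreal ((cmod (f x))\<^sup>2 / 2) * ennreal (heat_kernel r (y - x)) +
       ennreal ((cmod (f y))\<^sup>2 / 2) * ennreal (heat_kernel r (y - x)) \<partial>lborel \<partial>lborel)"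
  proof (intro nn_integral_mono)
    fix x y :: 'a
    have "cmod (f x) * cmod (f y) \<le> (cmod (f x))\<^sup>2 / 2 + (cmod (f y))\<^sup>2 / 2"
      using sum_squares_bound[of "cmod (f x)" "cmod (f y)"] by simp
    from mult_right_mono[OF this heat_kernel_nonneg[OF r, of "y - x"]]
    have "ennreal (cmod (f x) * cmod (f y) * heat_kernel r (y - x)) \<le>
       ennreal ((cmod (f x))\<^sup>2 / 2 * heat_kernel r (y - x) + (cmod (f y))\<^sup>2 / 2 * heat_kernel r (y - x))"
      by (simp only: distrib_right ennreal_leI)
    also have "\<dots> = ennreal ((cmod (f x))\<^sup>2 / 2) * ennreal (heat_kernel r (y - x)) +
       ennreal ((cmod (f y))\<^sup>2 / 2) * ennreal (heat_kernel r (y - x))"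
      using heat_kernel_nonneg[OF r, of "y - x"] by (subst ennreal_plus) (simp_all only: ennreal_mult'', auto)
    finally show "ennreal (cmod (f x) * cmod (f y) * heat_kernel r (y - x)) \<le>
       ennreal ((cmod (f x))\<^sup>2 / 2) * ennreal (heat_kernel r (y - x)) +
       ennreal ((cmod (f y))\<^sup>2 / 2) * ennreal (heat_kernel r (y - x))" .
  qed
  also have "\<dots> = (\<integral>\<^sup>+ x. \<integral>\<^sup>+ y. ennreal ((cmod (f x))\<^sup>2 / 2) * ennreal (heat_kernel r (y - x)) \<partial>lborel \<partial>lborel) +
     (\<integral>\<^sup>+ x. \<integral>\<^sup>+ y. ennreal ((cmod (f y))\<^sup>2 / 2) * ennreal (heat_kernel r (y - x)) \<partial>lborel \<partial>lborel)"
    by (simp add: nn_integral_add)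
  also have "(\<integral>\<^sup>+ x. \<integral>\<^sup>+ y. ennreal ((cmod (f y))\<^sup>2 / 2) * ennreal (heat_kernel r (y - x)) \<partial>lborel \<partial>lborel) =
      (\<integral>\<^sup>+ y. \<integral>\<^sup>+ x. ennreal ((cmod (f y))\<^sup>2 / 2) * ennreal (heat_kernel r (x - y)) \<partial>lborel \<partial>lborel)"
    by (subst lborel_pair.Fubini') (auto simp: heat_kernel_diff_commute)
  also have "(\<integral>\<^sup>+ x. \<integral>\<^sup>+ y. ennreal ((cmod (f x))\<^sup>2 / 2) * ennreal (heat_kernel r (y - x)) \<partial>lborel \<partial>lborel) +
      (\<integral>\<^sup>+ y. \<integral>\<^sup>+ x. ennreal ((cmod (f y))\<^sup>2 / 2) * ennreal (heat_kernel r (x - y)) \<partial>lborel \<partial>lborel)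
      = (\<integral>\<^sup>+ x. ennreal ((cmod (f x))\<^sup>2 / 2) \<partial>lborel) + (\<integral>\<^sup>+ x. ennreal ((cmod (f x))\<^sup>2 / 2) \<partial>lborel)"
    by (simp add: nn_integral_cmult heat_kernel_nn_integral[OF r])
  also have "\<dots> = energy f"
    unfolding energy_def by (subst nn_integral_add[symmetric]) (auto simp: ennreal_plus[symmetric] simp del: ennreal_plus)
  finally show ?thesis .
qed

text \<open>
  The weight \<open>gauss r\<close> is removed by letting \<open>r\<close> tend to 0, with Fatou's lemma.
\<close>

theorem fourier_integral_energy_le:
  fixes f :: "'a::euclidean_space \<Rightarrow> complex"
  assumes f: "integrable lborel f"
  shows "energy (fourier_integral f) \<le> energy f"
proof -
  have [measurable]: "f \<in> borel_measurable borel" using f by auto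
  let ?F = "fourier_integral f"
  let ?r = "\<lambda>n. 1 / real (Suc n)"
  have lim: "(\<lambda>n. ennreal ((cmod (?F z))\<^sup>2 * gauss (?r n) z)) \<longlonglongrightarrow> ennreal ((cmod (?F z))\<^sup>2)" for z
  proof -
    have "(\<lambda>n. (cmod (?F z))\<^sup>2 * gauss (?r n) z) \<longlonglongrightarrow> (cmod (?F z))\<^sup>2 * exp (- (0\<^sup>2 * (norm z)\<^sup>2 / 2))"
      unfolding gauss_def by (intro tendsto_intros LIMSEQ_Suc[OF lim_1_over_n]) auto
    then show ?thesis by (intro tendsto_ennrealI) simp
  qed
  have "energy ?F = (\<integral>\<^sup>+ z. liminf (\<lambda>n. ennreal ((cmod (?F z))\<^sup>2 * gauss (?r n) z)) \<partial>lborel)"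
    unfolding energy_def using lim_imp_Liminf[OF _ lim] by simp
  also have "\<dots> \<le> liminf (\<lambda>n. \<integral>\<^sup>+ z. ennreal ((cmod (?F z))\<^sup>2 * gauss (?r n) z) \<partial>lborel)"
    by (rule nn_integral_liminf) measurable
  also have "\<dots> \<le> liminf (\<lambda>n. energy f)"
    by (intro Liminf_mono always_eventually allI gauss_weighted_energy_le f) simp
  also have "\<dots> = energy f" by (simp add: Liminf_const)
  finally show ?thesis .
qed

section \<open>Completeness of the space of square-integrable functions\<close>

lemma energy_Cauchy_Schwarz:
  assumes [measurable]: "f \<in> borel_measurable borel" "g \<in> borel_measurable borel"
  shows "(\<integral>\<^sup>+ x. ennreal (cmod (f x * g x)) \<partial>lborel)\<^sup>2 \<le> energy f * energy g"
  using Cauchy_Schwarz_nn_integral[of "\<lambda>x. ennreal (cmod (f x))" lborel "\<lambda>x. ennreal (cmod (g x))"]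
  by (simp add: energy_def norm_mult ennreal_mult ennreal_power)

lemma cmod_integral_mult_sq_le:
  assumes f: "f \<in> L2" and g: "g \<in> L2"
  shows "ennreal ((LINT x|lborel. cmod (f x * g x))\<^sup>2) \<le> energy f * energy g"
proof -
  have [measurable]: "f \<in> borel_measurable borel" "g \<in> borel_measurable borel"
    using f g by (auto simp: L2_def)
  have "ennreal (LINT x|lborel. cmod (f x * g x)) = (\<integral>\<^sup>+ x. ennreal (cmod (f x * g x)) \<partial>lborel)"
    using integrable_L2_mult[OF f g] by (intro nn_integral_eq_integral[symmetric]) auto
  then have "ennreal ((LINT x|lborel. cmod (f x * g x))\<^sup>2) = (\<integral>\<^sup>+ x. ennreal (cmod (f x * g x)) \<partial>lborel)\<^sup>2"
    by (subst ennreal_power[symmetric]) auto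
  then show ?thesis
    using energy_Cauchy_Schwarz[of f g] by simp
qed

lemma gauss_L2: "r > 0 \<Longrightarrow> (\<lambda>x::'a::euclidean_space. complex_of_real (gauss r x)) \<in> L2"
proof -
  assume r: "r > 0"
  have "integrable lborel (\<lambda>x::'a. (cmod (complex_of_real (gauss r x)))\<^sup>2)"
  proof (rule Bochner_Integration.integrable_bound[OF gauss_integrable[OF r]])
    show "AE x in lborel. norm ((cmod (complex_of_real (gauss r x)))\<^sup>2) \<le> norm (complex_of_real (gauss r x))"
      by (auto simp: power2_eq_square mult_left_le gauss_le_1)
  qed measurable
  then show ?thesis by (simp add: L2_def)
qed

lemma ennreal_le_square_imp_le: "ennreal (a\<^sup>2) \<le> ennreal (b\<^sup>2) \<Longrightarrow> 0 \<le> b \<Longrightarrow> a \<le> b"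
  by (metis ennreal_le_iff power2_le_imp_le zero_le_power2)

lemma ennreal_tendsto_0_bound:
  fixes f g :: "'b \<Rightarrow> ennreal"
  assumes "(g \<longlongrightarrow> 0) F" "\<And>x. f x \<le> g x"
  shows "(f \<longlongrightarrow> 0) F"
  by (rule tendsto_sandwich[OF always_eventually always_eventually tendsto_const assms(1)])
    (simp_all add: assms(2))

text \<open>
  A weight that is positive everywhere and square integrable turns a Cauchy sequence of \<open>L2\<close> into
  one of \<open>L1\<close>. Hence a subsequence converges almost everywhere, and by Fatou's lemma its limit is
  the limit of the whole sequence in \<open>L2\<close>.
\<close>

theorem L2_complete:
  fixes F :: "nat \<Rightarrow> 'a::euclidean_space \<Rightarrow> complex"
  assumes F: "\<And>n. F n \<in> L2"
    and Cauchy: "\<And>e. e > 0 \<Longrightarrow> \<exists>N. \<forall>m\<ge>N. \<forall>n\<ge>N. energy (\<lambda>x. F m x - F n x) \<le> ennreal e"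
  obtains g where "g \<in> L2" "(\<lambda>n. energy (\<lambda>x. F n x - g x)) \<longlonglongrightarrow> 0"
proof -
  have [measurable]: "F n \<in> borel_measurable borel" for n using F by (simp add: L2_def)
  let ?w = "\<lambda>x::'a. complex_of_real (gauss 1 x)"
  define W where "W = (LINT x|lborel. (cmod (?w (x::'a)))\<^sup>2)"
  have w: "?w \<in> L2" by (simp add: gauss_L2)
  have W: "energy ?w = ennreal W" "0 \<le> W"
    using energy_eq_integral[OF w] by (auto simp: W_def)
  have "\<exists>N. \<forall>m\<ge>N. \<forall>n\<ge>N. (LINT x|lborel. cmod (?w x * F m x - ?w x * F n x)) < e" if e: "e > 0" for e
  proof -
    \<comment> \<open>The choice makes \<open>W * d \<le> (e / 2)\<^sup>2\<close>; adding 1 avoids a division by 0.\<close>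
    define d where "d = (e / 2)\<^sup>2 / (W + 1)"
    have d: "d > 0" using e W by (simp add: d_def)
    have Wd: "W * d \<le> (e / 2)\<^sup>2"
    proof -
      have "W * d = (e / 2)\<^sup>2 * (W / (W + 1))" by (simp add: d_def)
      also have "\<dots> \<le> (e / 2)\<^sup>2" using W by (intro mult_left_le) auto
      finally show ?thesis .
    qed
    obtain N where N: "\<And>m n. m \<ge> N \<Longrightarrow> n \<ge> N \<Longrightarrow> energy (\<lambda>x. F m x - F n x) \<le> ennreal d"
      using Cauchy[OF d] by blast
    have "(LINT x|lborel. cmod (?w x * F m x - ?w x * F n x)) < e" if "m \<ge> N" "n \<ge> N" for m n
    proof -
      have "ennreal ((LINT x|lborel. cmod (?w x * (F m x - F n x)))\<^sup>2)
          \<le> energy ?w * energy (\<lambda>x. F m x - F n x)"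
        by (intro cmod_integral_mult_sq_le w L2_diff F)
      also have "\<dots> \<le> ennreal W * ennreal d"
        unfolding W by (intro mult_left_mono N that) simp
      also have "\<dots> = ennreal (W * d)" using W d by (simp add: ennreal_mult)
      also have "\<dots> \<le> ennreal ((e / 2)\<^sup>2)" using Wd by (rule ennreal_leI)
      finally have "(LINT x|lborel. cmod (?w x * (F m x - F n x))) \<le> e / 2"
        by (rule ennreal_le_square_imp_le) (use e in simp)
      then show ?thesis using e by (simp add: right_diff_distrib)
    qed
    then show ?thesis by blast
  qed
  then obtain r where r: "strict_mono r" "AE x in lborel. Cauchy (\<lambda>i. ?w x * F (r i) x)"
    using cauchy_L1_AE_cauchy_subseq[of lborel "\<lambda>n x. ?w x * F n x"] integrable_L2_mult[OF w F] by blast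
  define g where "g x = lim (\<lambda>i. F (r i) x)" for x
  have [measurable]: "g \<in> borel_measurable borel" unfolding g_def by measurable
  have lim: "AE x in lborel. (\<lambda>i. F (r i) x) \<longlonglongrightarrow> g x"
    using r(2)
  proof eventually_elim
    case (elim x)
    then have "convergent (\<lambda>i. ?w x * F (r i) x)" by (simp add: Cauchy_convergent_iff)
    moreover have "?w x \<noteq> 0" using gauss_pos[of 1 x] by (metis of_real_eq_0_iff less_irrefl)
    ultimately have "convergent (\<lambda>i. F (r i) x)" using convergent_mult_const_iff by blast
    then show ?case by (simp add: g_def convergent_LIMSEQ_iff)
  qed
  have small: "\<exists>N. \<forall>n\<ge>N. energy (\<lambda>x. F n x - g x) \<le> ennreal e" if e: "e > 0" for e
  proof -
    obtain N where N: "\<And>m n. m \<ge> N \<Longrightarrow> n \<ge> N \<Longrightarrow> energy (\<lambda>x. F m x - F n x) \<le> ennreal e"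
      using Cauchy[OF e] by blast
    have "energy (\<lambda>x. F n x - g x) \<le> ennreal e" if n: "n \<ge> N" for n
    proof -
      have "energy (\<lambda>x. F n x - g x) = (\<integral>\<^sup>+ x. liminf (\<lambda>i. ennreal ((cmod (F n x - F (r i) x))\<^sup>2)) \<partial>lborel)"
        unfolding energy_def
      proof (rule nn_integral_cong_AE, use lim in eventually_elim)
        fix x assume "(\<lambda>i. F (r i) x) \<longlonglongrightarrow> g x"
        then have "(\<lambda>i. ennreal ((cmod (F n x - F (r i) x))\<^sup>2)) \<longlonglongrightarrow> ennreal ((cmod (F n x - g x))\<^sup>2)"
          by (intro tendsto_ennrealI tendsto_intros)
        from lim_imp_Liminf[OF _ this]
        show "ennreal ((cmod (F n x - g x))\<^sup>2) = liminf (\<lambda>i. ennreal ((cmod (F n x - F (r i) x))\<^sup>2))"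
          by simp
      qed
      also have "\<dots> \<le> liminf (\<lambda>i. energy (\<lambda>x. F n x - F (r i) x))"
        unfolding energy_def by (rule nn_integral_liminf) measurable
      also have "\<dots> \<le> liminf (\<lambda>i::nat. ennreal e)"
      proof (rule Liminf_mono)
        show "\<forall>\<^sub>F i in sequentially. energy (\<lambda>x. F n x - F (r i) x) \<le> ennreal e"
          using N[OF n] seq_suble[OF r(1)] by (auto simp: eventually_sequentially intro!: exI[of _ N] intro: order_trans)
      qed
      also have "\<dots> = ennreal e" by (simp add: Liminf_const)
      finally show ?thesis .
    qed
    then show ?thesis by blast
  qed
  have "(\<lambda>n. energy (\<lambda>x. F n x - g x)) \<longlonglongrightarrow> 0"
  proof (rule tendsto_0_if_Limsup_eq_0_ennreal)
    show "limsup (\<lambda>n. energy (\<lambda>x. F n x - g x)) = 0"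
    proof (rule antisym)
      show "limsup (\<lambda>n. energy (\<lambda>x. F n x - g x)) \<le> 0"
      proof (rule ennreal_le_epsilon)
        fix e :: real assume "e > 0"
        then have "limsup (\<lambda>n. energy (\<lambda>x. F n x - g x)) \<le> ennreal e"
          using small[of e] by (intro Limsup_bounded) (auto simp: eventually_sequentially)
        then show "limsup (\<lambda>n. energy (\<lambda>x. F n x - g x)) \<le> 0 + ennreal e" by simp
      qed
    qed simp
  qed
  moreover have "g \<in> L2"
  proof -
    obtain n where "energy (\<lambda>x. F n x - g x) \<le> ennreal 1" using small[of 1] by auto
    then have "(\<lambda>x. F n x - g x) \<in> L2" by (auto simp: L2_iff_energy order_le_less_trans)
    from L2_diff[OF F[of n] this] show ?thesis by simp
  qed
  ultimately show thesis using that by blast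
qed

text \<open>
  Strong convergence implies weak convergence, by Cauchy and Schwarz.
\<close>

lemma energy_tendsto_weakly:
  assumes A: "\<And>n. A n \<in> L2" and a: "a \<in> L2" and g: "g \<in> L2"
    and lim: "(\<lambda>n. energy (\<lambda>x. A n x - a x)) \<longlonglongrightarrow> 0"
  shows "(\<lambda>n. LINT x|lborel. g x * A n x) \<longlonglongrightarrow> (LINT x|lborel. g x * a x)"
proof -
  let ?d = "\<lambda>n. (LINT x|lborel. g x * A n x) - (LINT x|lborel. g x * a x)"
  have fin: "energy g \<noteq> \<infinity>" using g by (auto simp: L2_iff_energy)
  have le: "ennreal ((cmod (?d n))\<^sup>2) \<le> energy g * energy (\<lambda>x. A n x - a x)" for n
  proof -
    have "?d n = (LINT x|lborel. g x * (A n x - a x))"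
      using integrable_L2_mult[OF g A[of n]] integrable_L2_mult[OF g a]
      by (simp add: right_diff_distrib)
    then have "cmod (?d n) \<le> (LINT x|lborel. cmod (g x * (A n x - a x)))"
      by (simp only: integral_norm_bound)
    then have "ennreal ((cmod (?d n))\<^sup>2) \<le> ennreal ((LINT x|lborel. cmod (g x * (A n x - a x)))\<^sup>2)"
      by (intro ennreal_leI power_mono) auto
    also have "\<dots> \<le> energy g * energy (\<lambda>x. A n x - a x)"
      by (intro cmod_integral_mult_sq_le g L2_diff A a)
    finally show ?thesis .
  qed
  have "(\<lambda>n. energy g * energy (\<lambda>x. A n x - a x)) \<longlonglongrightarrow> energy g * 0"
    using fin by (intro ennreal_tendsto_cmult lim) (auto simp: top.not_eq_extremum)
  then have "(\<lambda>n. ennreal ((cmod (?d n))\<^sup>2)) \<longlonglongrightarrow> ennreal 0"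
    unfolding mult_zero_right ennreal_0 by (rule ennreal_tendsto_0_bound) (rule le)
  then have "(\<lambda>n. (cmod (?d n))\<^sup>2) \<longlonglongrightarrow> 0"
    by (subst (asm) tendsto_ennreal_iff) auto
  from tendsto_real_sqrt[OF this] have "(\<lambda>n. cmod (?d n)) \<longlonglongrightarrow> 0" by simp
  then show ?thesis
    by (subst LIM_zero_iff[symmetric]) (rule tendsto_norm_zero_cancel)
qed

section \<open>The Fourier transform of square-integrable functions\<close>

lemma is_fourier_iff: "is_fourier f g \<longleftrightarrow> g \<in> L2 \<and>
    (\<lambda>n. energy (\<lambda>z. fourier_integral (truncate n f) z - g z)) \<longlonglongrightarrow> 0"
  by (simp add: is_fourier_def energy_def)

lemma fourier_integral_L2: "integrable lborel f \<Longrightarrow> f \<in> L2 \<Longrightarrow> fourier_integral f \<in> L2"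
  using order_le_less_trans[OF fourier_integral_energy_le[of f]] by (auto simp: L2_iff_energy)

text \<open>
  The transforms of the truncations form a Cauchy sequence because the Fourier integral does not
  increase the energy of an integrable function.
\<close>

lemma is_fourier_exists:
  assumes f: "f \<in> L2"
  shows "\<exists>g. is_fourier f g"
proof -
  have [measurable]: "f \<in> borel_measurable borel" using f by (simp add: L2_def)
  let ?F = "\<lambda>n. fourier_integral (truncate n f)"
  have "\<exists>N. \<forall>m\<ge>N. \<forall>n\<ge>N. energy (\<lambda>x. ?F m x - ?F n x) \<le> ennreal e" if e: "e > 0" for e
  proof -
    have "\<forall>\<^sub>F n in sequentially. energy (\<lambda>x. truncate n f x - f x) < ennreal (e / 4)"
      using e by (intro order_tendstoD[OF truncate_tendsto[OF f]]) auto
    then obtain N where N: "\<And>n. n \<ge> N \<Longrightarrow> energy (\<lambda>x. truncate n f x - f x) \<le> ennreal (e / 4)"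
      by (auto simp: eventually_sequentially intro: less_imp_le)
    have "energy (\<lambda>x. ?F m x - ?F n x) \<le> ennreal e" if "m \<ge> N" "n \<ge> N" for m n
    proof -
      have "(\<lambda>z. ?F m z - ?F n z) = fourier_integral (\<lambda>x. truncate m f x - truncate n f x)"
        by (rule ext, rule fourier_integral_diff[symmetric]; rule truncate_integrable[OF f])
      then have "energy (\<lambda>z. ?F m z - ?F n z) \<le> energy (\<lambda>x. truncate m f x - truncate n f x)"
        using fourier_integral_energy_le[OF Bochner_Integration.integrable_diff[OF
            truncate_integrable[OF f, of m] truncate_integrable[OF f, of n]]] by (simp only:)
      also have "\<dots> \<le> 2 * energy (\<lambda>x. truncate m f x - f x) + 2 * energy (\<lambda>x. f x - truncate n f x)"
        by (intro energy_triangle truncate_measurable) fact+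
      also have "\<dots> \<le> 2 * ennreal (e / 4) + 2 * ennreal (e / 4)"
        using N that by (intro add_mono mult_left_mono) (auto simp: energy_diff_commute[of f])
      also have "\<dots> = ennreal e"
        using e by (simp add: ennreal_plus[symmetric] ennreal_mult[symmetric] flip: ennreal_numeral del: ennreal_plus)
      finally show ?thesis .
    qed
    then show ?thesis by blast
  qed
  then obtain g where "g \<in> L2" "(\<lambda>n. energy (\<lambda>x. ?F n x - g x)) \<longlonglongrightarrow> 0"
    using L2_complete[of ?F] fourier_integral_L2[OF truncate_integrable[OF f] truncate_L2[OF f]] by blast
  then show ?thesis by (auto simp: is_fourier_iff)
qed

lemma is_fourier_fourier: "f \<in> L2 \<Longrightarrow> is_fourier f (fourier f)"
  unfolding fourier_def using someI_ex[OF is_fourier_exists] .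

lemma fourier_L2: "f \<in> L2 \<Longrightarrow> fourier f \<in> L2"
  using is_fourier_fourier by (auto simp: is_fourier_iff)

text \<open>
  \<^const>\<open>fourier\<close> is a choice among almost everywhere equal representatives; properties of the
  transform are obtained by exhibiting another limit of the transforms of the truncations.
\<close>

lemma fourier_AE_unique:
  assumes f: "f \<in> L2" and g: "g \<in> borel_measurable borel"
    and lim: "(\<lambda>n. energy (\<lambda>z. fourier_integral (truncate n f) z - g z)) \<longlonglongrightarrow> 0"
  shows "AE z in lborel. fourier f z = g z"
proof (rule energy_tendsto_unique[OF _ _ g _ lim])
  show "fourier_integral (truncate n f) \<in> borel_measurable borel" for n
    using f by (intro fourier_integral_measurable truncate_measurable) (simp add: L2_def)
qed (use fourier_L2[OF f] is_fourier_fourier[OF f] in \<open>auto simp: is_fourier_iff L2_def\<close>)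

lemma fourier_eq_fourier_integral:
  assumes f: "f \<in> L2" and int: "integrable lborel f"
  shows "AE z in lborel. fourier f z = fourier_integral f z"
proof (rule fourier_AE_unique[OF f])
  show "fourier_integral f \<in> borel_measurable borel" using int by (intro fourier_integral_measurable) auto
  have eq: "(\<lambda>z. fourier_integral (truncate n f) z - fourier_integral f z)
      = fourier_integral (\<lambda>x. truncate n f x - f x)" for n
    by (rule ext, rule fourier_integral_diff[symmetric]) (fact truncate_integrable[OF f] int)+
  show "(\<lambda>n. energy (\<lambda>z. fourier_integral (truncate n f) z - fourier_integral f z)) \<longlonglongrightarrow> 0"
    unfolding eq
  proof (rule tendsto_sandwich[OF _ _ tendsto_const truncate_tendsto[OF f]])
    show "\<forall>\<^sub>F n in sequentially. energy (fourier_integral (\<lambda>x. truncate n f x - f x))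
        \<le> energy (\<lambda>x. truncate n f x - f x)"
      by (intro always_eventually allI fourier_integral_energy_le Bochner_Integration.integrable_diff
          truncate_integrable f int)
  qed auto
qed

lemma fourier_diff:
  assumes f: "f \<in> L2" and g: "g \<in> L2"
  shows "AE z in lborel. fourier (\<lambda>x. f x - g x) z = fourier f z - fourier g z"
proof (rule fourier_AE_unique[OF L2_diff[OF f g]])
  have [measurable]: "f \<in> borel_measurable borel" "g \<in> borel_measurable borel"
     "fourier f \<in> borel_measurable borel" "fourier g \<in> borel_measurable borel"
    using f g fourier_L2[OF f] fourier_L2[OF g] by (auto simp: L2_def)
  show "(\<lambda>z. fourier f z - fourier g z) \<in> borel_measurable borel" by measurable
  let ?F = "\<lambda>n f. fourier_integral (truncate n f)"
  have eq: "?F n (\<lambda>x. f x - g x) z - (fourier f z - fourier g z)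
      = (?F n f z - fourier f z) - (?F n g z - fourier g z)" for n z
    using fourier_integral_diff[OF truncate_integrable[OF f, of n] truncate_integrable[OF g, of n], of z]
    by (simp add: right_diff_distrib)
  have lim: "(\<lambda>n. 2 * energy (\<lambda>z. ?F n f z - fourier f z) + 2 * energy (\<lambda>z. ?F n g z - fourier g z))
      \<longlonglongrightarrow> 2 * 0 + 2 * 0"
    using is_fourier_fourier[OF f] is_fourier_fourier[OF g]
    by (intro tendsto_intros ennreal_tendsto_cmult) (auto simp: is_fourier_iff)
  have le: "energy (\<lambda>z. ?F n (\<lambda>x. f x - g x) z - (fourier f z - fourier g z)) \<le>
      2 * energy (\<lambda>z. ?F n f z - fourier f z) + 2 * energy (\<lambda>z. ?F n g z - fourier g z)" for n
    unfolding eq by (rule energy_diff_le) measurable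
  show "(\<lambda>n. energy (\<lambda>z. ?F n (\<lambda>x. f x - g x) z - (fourier f z - fourier g z))) \<longlonglongrightarrow> 0"
    using ennreal_tendsto_0_bound[OF lim[unfolded mult_zero_right add_0_left] le] .
qed

text \<open>
  Boundedness of the transform on \<open>L2\<close>. The factor 2 is the one in the triangle inequality for
  the energy.
\<close>

lemma fourier_energy_le:
  assumes f: "f \<in> L2"
  shows "energy (fourier f) \<le> 2 * energy f"
proof -
  have [measurable]: "f \<in> borel_measurable borel" "fourier f \<in> borel_measurable borel"
    using f fourier_L2[OF f] by (auto simp: L2_def)
  let ?F = "\<lambda>n. fourier_integral (truncate n f)"
  have "energy (fourier f) \<le> 2 * energy f + 2 * energy (\<lambda>z. ?F n z - fourier f z)" for n
  proof -
    have "energy (fourier f) \<le> 2 * energy (?F n) + 2 * energy (\<lambda>z. ?F n z - fourier f z)"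
      using energy_diff_le[of "?F n" "\<lambda>z. ?F n z - fourier f z"] by simp
    also have "energy (?F n) \<le> energy (truncate n f)"
      by (intro fourier_integral_energy_le truncate_integrable f)
    also have "\<dots> \<le> energy f" by (intro energy_mono) (auto simp: indicator_def)
    finally show ?thesis by (simp add: mult_left_mono)
  qed
  moreover have "(\<lambda>n. 2 * energy f + 2 * energy (\<lambda>z. ?F n z - fourier f z)) \<longlonglongrightarrow> 2 * energy f + 2 * 0"
    using is_fourier_fourier[OF f] by (intro tendsto_intros ennreal_tendsto_cmult) (auto simp: is_fourier_iff)
  ultimately have "energy (fourier f) \<le> 2 * energy f + 2 * 0"
    by (intro LIMSEQ_le_const) auto
  then show ?thesis by simp
qed

lemma fourier_energy_continuous:
  assumes F: "\<And>n. F n \<in> L2" and f: "f \<in> L2" and lim: "(\<lambda>n. energy (\<lambda>x. F n x - f x)) \<longlonglongrightarrow> 0"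
  shows "(\<lambda>n. energy (\<lambda>z. fourier (F n) z - fourier f z)) \<longlonglongrightarrow> 0"
proof -
  have "energy (\<lambda>z. fourier (F n) z - fourier f z) \<le> 2 * energy (\<lambda>x. F n x - f x)" for n
  proof -
    have "energy (\<lambda>z. fourier (F n) z - fourier f z) = energy (fourier (\<lambda>x. F n x - f x))"
      using fourier_diff[OF F f, of n] by (intro energy_cong_AE) auto
    also have "\<dots> \<le> 2 * energy (\<lambda>x. F n x - f x)" by (intro fourier_energy_le L2_diff F f)
    finally show ?thesis .
  qed
  moreover have "(\<lambda>n. 2 * energy (\<lambda>x. F n x - f x)) \<longlonglongrightarrow> 2 * 0"
    by (intro ennreal_tendsto_cmult lim) auto
  ultimately show ?thesis
    by (intro ennreal_tendsto_0_bound[where f="\<lambda>n. energy (\<lambda>z. fourier (F n) z - fourier f z)"]) (simp_all only: mult_zero_right)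
qed

section \<open>Fourier inversion\<close>

text \<open>
  After the substitution \<open>y = x + r v\<close> the kernel no longer depends on \<open>r\<close>, and the bounded
  continuous function \<open>\<phi>\<close> is evaluated at points that tend to \<open>x\<close>.
\<close>

lemma heat_kernel_approximate_identity:
  fixes \<phi> :: "'a::euclidean_space \<Rightarrow> complex"
  assumes cont: "continuous_on UNIV \<phi>" and bound: "\<And>x. cmod (\<phi> x) \<le> B"
  shows "(\<lambda>n. LINT y|lborel. \<phi> y * of_real (heat_kernel (1 / real (Suc n)) (y - x))) \<longlonglongrightarrow> \<phi> x"
proof -
  have [measurable]: "\<phi> \<in> borel_measurable borel"
    using cont by (rule borel_measurable_continuous_onI)
  let ?r = "\<lambda>n. 1 / real (Suc n)"
  have std: "integrable lborel (heat_kernel 1 :: 'a \<Rightarrow> real)" "(LINT v|lborel. heat_kernel 1 (v::'a)) = 1"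
    using heat_kernel_integral[of 1, where 'a='a] by (auto simp: has_bochner_integral_iff)
  have scaled: "(LINT y|lborel. \<phi> y * of_real (heat_kernel r (y - x)))
      = (LINT v|lborel. \<phi> (x + r *\<^sub>R v) * of_real (heat_kernel 1 v))" if r: "r > 0" for r
  proof -
    have "r ^ DIM('a) * heat_kernel r (r *\<^sub>R v) = heat_kernel 1 v" for v :: 'a
      using r by (simp add: heat_kernel_def gauss_scale)
    then have "r ^ DIM('a) *\<^sub>R (\<phi> (x + r *\<^sub>R v) * of_real (heat_kernel r (r *\<^sub>R v)))
        = \<phi> (x + r *\<^sub>R v) * of_real (heat_kernel 1 v)" for v
      by (metis mult.left_commute of_real_mult scaleR_conv_of_real)
    then show ?thesis
      using r by (subst lborel_integral_affine[where c=r and t=x]) (auto simp flip: integral_scaleR_right)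
  qed
  have "(\<lambda>n. LINT v|lborel. \<phi> (x + ?r n *\<^sub>R v) * of_real (heat_kernel 1 v))
      \<longlonglongrightarrow> (LINT v|lborel. \<phi> x * of_real (heat_kernel 1 (v::'a)))"
  proof (rule integral_dominated_convergence[where w="\<lambda>v::'a. B * heat_kernel 1 v"])
    show "integrable lborel (\<lambda>v::'a. B * heat_kernel 1 v)" using std by simp
    show "AE v in lborel. (\<lambda>n. \<phi> (x + ?r n *\<^sub>R v) * of_real (heat_kernel 1 v)) \<longlonglongrightarrow> \<phi> x * of_real (heat_kernel 1 v)"
    proof (intro AE_I2 tendsto_mult tendsto_const)
      fix v
      have "(\<lambda>n. x + ?r n *\<^sub>R v) \<longlonglongrightarrow> x + 0 *\<^sub>R v"
        by (intro tendsto_intros LIMSEQ_Suc[OF lim_1_over_n])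
      then have "(\<lambda>n. x + ?r n *\<^sub>R v) \<longlonglongrightarrow> x" by simp
      then show "(\<lambda>n. \<phi> (x + ?r n *\<^sub>R v)) \<longlonglongrightarrow> \<phi> x"
        by (rule continuous_on_tendsto_compose[OF cont]) auto
    qed
    show "AE v in lborel. norm (\<phi> (x + ?r n *\<^sub>R v) * of_real (heat_kernel 1 v)) \<le> B * heat_kernel 1 v" for n
      using bound by (auto simp: norm_mult heat_kernel_nonneg intro!: mult_right_mono)
  qed measurable
  moreover have "(LINT v|lborel. \<phi> x * complex_of_real (heat_kernel 1 (v::'a))) = \<phi> x"
    using std by simp
  ultimately show ?thesis by (simp add: scaled std)
qed

lemma cmod_heat_convolution_le:
  fixes \<phi> :: "'a::euclidean_space \<Rightarrow> complex"
  assumes [measurable]: "\<phi> \<in> borel_measurable borel" and bound: "\<And>x. cmod (\<phi> x) \<le> B" and r: "r > 0"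
  shows "cmod (LINT y|lborel. \<phi> y * of_real (heat_kernel r (y - x))) \<le> B"
proof -
  have int: "integrable lborel (\<lambda>y. heat_kernel r (y - x))" "(LINT y|lborel. heat_kernel r (y - x)) = 1"
    using heat_kernel_integral[OF r, where 'a='a]
      lborel_integrable_affine[of "heat_kernel r" 1 "- x"] lborel_integral_affine[of "heat_kernel r" 1 "- x"]
    by (auto simp: has_bochner_integral_iff)
  have le: "cmod (\<phi> y * of_real (heat_kernel r (y - x))) \<le> B * heat_kernel r (y - x)" for y
    using bound by (auto simp: norm_mult heat_kernel_nonneg[OF r] intro!: mult_right_mono)
  have "cmod (LINT y|lborel. \<phi> y * of_real (heat_kernel r (y - x))) \<le> (LINT y|lborel. B * heat_kernel r (y - x))"
  proof (rule Bochner_Integration.integral_norm_bound_integral)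
    show B: "integrable lborel (\<lambda>y. B * heat_kernel r (y - x))" using int by simp
    show "integrable lborel (\<lambda>y. \<phi> y * of_real (heat_kernel r (y - x)))"
      by (rule Bochner_Integration.integrable_bound[OF B])
         (measurable, use le in \<open>auto intro!: AE_I2 intro: order_trans[OF le]\<close>)
  qed (use le in auto)
  then show ?thesis using int by simp
qed

lemma mollify_symmetric:
  fixes f g :: "'a::euclidean_space \<Rightarrow> complex"
  assumes f: "integrable lborel f" and g: "integrable lborel g" and r: "r > 0"
  shows "(LINT x|lborel. f x * mollify r g x) = (LINT x|lborel. g x * mollify r f x)"
proof -
  have [measurable]: "f \<in> borel_measurable borel" "g \<in> borel_measurable borel" using f g by auto
  have "(LINT x|lborel. f x * mollify r g x)
      = (LINT z|lborel. fourier_integral f z * (fourier_integral g (- z) * of_real (gauss r z)))"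
    unfolding mollify_def
    by (rule multiplication_formula[OF f integrable_fourier_integral_gauss(2)[OF g r], symmetric])
  also have "\<dots> = (LINT z|lborel. fourier_integral g z * (fourier_integral f (- z) * of_real (gauss r z)))"
    by (subst lborel_integral_affine[where c="-1" and t=0]) (auto simp: mult_ac)
  also have "\<dots> = (LINT x|lborel. g x * mollify r f x)"
    unfolding mollify_def
    by (rule multiplication_formula[OF g integrable_fourier_integral_gauss(2)[OF f r]])
  finally show ?thesis .
qed

text \<open>
  The indicator of an open set is a pointwise limit of continuous functions with values in \<open>[0, 1]\<close>.
  So \<open>w\<close> has integral 0 over open sets, and over all Borel sets by the \<open>\<pi>\<close>-\<open>\<lambda>\<close> theorem.
\<close>

lemma AE_zero_if_continuous_tests:
  fixes w :: "'a::euclidean_space \<Rightarrow> complex"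
  assumes w: "integrable lborel w"
    and test: "\<And>\<eta>::'a \<Rightarrow> real. continuous_on UNIV \<eta> \<Longrightarrow> (\<And>x. 0 \<le> \<eta> x) \<Longrightarrow> (\<And>x. \<eta> x \<le> 1) \<Longrightarrow>
      (LINT x|lborel. of_real (\<eta> x) * w x) = 0"
  shows "AE x in lborel. w x = 0"
proof (rule sigma_finite_measure.density_zero[OF sigma_finite_lborel w])
  have [measurable]: "w \<in> borel_measurable borel" using w by auto
  have int: "integrable lborel (\<lambda>x. indicator A x *\<^sub>R w x)" if "A \<in> sets borel" for A
    using integrable_mult_indicator[OF _ w, of A] that by simp
  have all: "(LINT x|lborel. w x) = 0"
    using test[of "\<lambda>_. 1"] by simp
  have open_zero: "(LINT x|lborel. indicator U x *\<^sub>R w x) = 0" if U: "open U" for U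
  \<comment> \<open>The approximating functions come from the distance to the complement of \<open>U\<close>. If \<open>U\<close> is the
    whole space, that complement is empty and \<open>infdist\<close> has the default value 0.\<close>
  proof (cases "U = UNIV")
    case False
    let ?\<eta> = "\<lambda>n x. min 1 (real n * infdist x (- U))"
    have cont: "continuous_on UNIV (?\<eta> n)" for n
      by (intro continuous_intros)
    have [measurable]: "?\<eta> n \<in> borel_measurable borel" for n
      by (rule borel_measurable_continuous_onI[OF cont])
    have "(\<lambda>n. LINT x|lborel. of_real (?\<eta> n x) * w x) \<longlonglongrightarrow> (LINT x|lborel. indicator U x *\<^sub>R w x)"
    proof (rule integral_dominated_convergence[where w="\<lambda>x. cmod (w x)"])
      show "(\<lambda>x. indicator U x *\<^sub>R w x) \<in> borel_measurable lborel"
        using int[of U] U by auto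
      show "(\<lambda>x. of_real (?\<eta> n x) * w x) \<in> borel_measurable lborel" for n
        by measurable
      show "integrable lborel (\<lambda>x. cmod (w x))" using w by simp
      show "AE x in lborel. (\<lambda>n. of_real (?\<eta> n x) * w x) \<longlonglongrightarrow> indicator U x *\<^sub>R w x"
      proof (rule AE_I2)
        fix x
        show "(\<lambda>n. of_real (?\<eta> n x) * w x) \<longlonglongrightarrow> indicator U x *\<^sub>R w x"
        proof (cases "x \<in> U")
          case True
          then have pos: "infdist x (- U) > 0"
            using False U by (intro infdist_pos_not_in_closed) auto
          obtain N where N: "1 / infdist x (- U) \<le> real N" using real_arch_simple by blast
          have "?\<eta> n x = 1" if "n \<ge> N" for n
          proof -
            have "1 / infdist x (- U) \<le> real n" using N that by linarith
            then show ?thesis using pos by (simp add: divide_le_eq)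
          qed
          then show ?thesis
            using True by (intro tendsto_eventually) (auto simp: eventually_sequentially intro!: exI[of _ N])
        qed simp
      qed
      show "AE x in lborel. norm (of_real (?\<eta> n x) * w x) \<le> cmod (w x)" for n
        by (intro AE_I2) (auto simp: norm_mult infdist_nonneg abs_of_nonneg intro!: mult_left_le_one_le)
    qed
    moreover have "(LINT x|lborel. of_real (?\<eta> n x) * w x) = 0" for n
      by (rule test[OF cont]) (auto simp: infdist_nonneg)
    ultimately show ?thesis by (simp add: LIMSEQ_const_iff)
  qed (use all in simp)
  fix A :: "'a set" assume "A \<in> sets lborel"
  then have A: "A \<in> sigma_sets UNIV {S. open S}" by (simp add: borel_def)
  have borel_iff: "A \<in> sigma_sets UNIV {S. open S} \<longleftrightarrow> A \<in> sets borel" for A :: "'a set"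
    by (simp add: borel_def)
  have "Int_stable {S :: 'a set. open S}" by (auto simp: Int_stable_def)
  from this subset_UNIV[of "{S. open S}", folded Pow_UNIV] A
  show "set_lebesgue_integral lborel A w = 0"
  proof (induction rule: sigma_sets_induct_disjoint)
    case (basic A)
    then show ?case using open_zero by (simp add: set_lebesgue_integral_def)
  next
    case (compl A)
    then have "A \<in> sets borel" by (simp add: borel_iff)
    then have "(LINT x|lborel. w x - indicator A x *\<^sub>R w x) = 0"
      using compl all int[of A] w by (simp add: set_lebesgue_integral_def)
    moreover have "indicator (UNIV - A) x *\<^sub>R w x = w x - indicator A x *\<^sub>R w x" for x
      by (auto simp: indicator_def)
    ultimately show ?case by (simp add: set_lebesgue_integral_def)
  next
    case (union A)
    then have A: "A i \<in> sets borel" for i using borel_iff by blast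
    have "(LINT x:(\<Union>i. A i)|lborel. w x) = (\<Sum>i. LINT x:A i|lborel. w x)"
    proof (rule lebesgue_integral_countable_add)
      show "set_integrable lborel (\<Union>i. A i) w"
        using int A by (auto simp: set_integrable_def)
    qed (use A union(1) in \<open>auto simp: disjoint_family_on_def\<close>)
    then show ?case using union by simp
  qed (auto simp: set_lebesgue_integral_def)
qed

text \<open>
  A square-integrable function need not be integrable. Multiplying it by a Gaussian makes it so, and
  turns bounded continuous test functions into integrable ones.
\<close>

lemma AE_zero_if_weakly_zero:
  fixes w :: "'a::euclidean_space \<Rightarrow> complex"
  assumes w: "w \<in> L2"
    and test: "\<And>\<phi>. continuous_on UNIV \<phi> \<Longrightarrow> \<phi> \<in> L2 \<Longrightarrow> integrable lborel \<phi> \<Longrightarrow>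
      (\<And>x. cmod (\<phi> x) \<le> 1) \<Longrightarrow> (LINT x|lborel. \<phi> x * w x) = 0"
  shows "AE x in lborel. w x = 0"
proof -
  let ?g = "\<lambda>x::'a. complex_of_real (gauss 1 x)"
  have cont_g: "continuous_on UNIV ?g"
    unfolding gauss_def by (intro continuous_intros) auto
  have "AE x in lborel. ?g x * w x = 0"
  proof (rule AE_zero_if_continuous_tests)
    show "integrable lborel (\<lambda>x. ?g x * w x)"
      by (rule integrable_L2_mult[OF gauss_L2 w]) simp
    fix \<eta> :: "'a \<Rightarrow> real"
    assume cont: "continuous_on UNIV \<eta>" and \<eta>: "\<And>x. 0 \<le> \<eta> x" "\<And>x. \<eta> x \<le> 1"
    let ?\<phi> = "\<lambda>x. of_real (\<eta> x) * ?g x"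
    have cont_\<phi>: "continuous_on UNIV ?\<phi>" by (intro continuous_intros cont cont_g)
    then have m: "?\<phi> \<in> borel_measurable borel" by (rule borel_measurable_continuous_onI)
    have le: "cmod (?\<phi> x) \<le> cmod (?g x)" for x
      using \<eta> by (simp add: norm_mult mult_left_le_one_le)
    have "(LINT x|lborel. ?\<phi> x * w x) = 0"
    proof (rule test[OF cont_\<phi>])
      show "?\<phi> \<in> L2" by (rule L2_dominated[OF gauss_L2 m le]) simp
      show "integrable lborel ?\<phi>"
        by (rule Bochner_Integration.integrable_bound[OF gauss_integrable[of 1]]) (use m le in auto)
      show "cmod (?\<phi> x) \<le> 1" for x
        using order_trans[OF le[of x]] by (simp add: gauss_le_1)
    qed
    then show "(LINT x|lborel. of_real (\<eta> x) * (?g x * w x)) = 0" by (simp add: mult.assoc)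
  qed
  then show ?thesis by eventually_elim (simp add: less_imp_neq[OF gauss_pos, symmetric])
qed

lemma energy_reflect:
  assumes [measurable]: "f \<in> borel_measurable borel"
  shows "energy (\<lambda>x. f (- x)) = energy f"
  unfolding energy_def by (subst (2) lborel_nn_integral_affine[where c="-1" and t=0]) auto

lemma L2_reflect:
  assumes "f \<in> L2"
  shows "(\<lambda>x. f (- x)) \<in> L2"
proof -
  have [measurable]: "f \<in> borel_measurable borel" using assms by (simp add: L2_def)
  show ?thesis using assms energy_reflect[of f] by (auto simp: L2_iff_energy)
qed

text \<open>
  The identity is tested against functions \<open>\<phi>\<close>. As \<open>r\<close> tends to 0, \<open>mollify r g\<close> converges in \<open>L2\<close>
  to the left-hand side, by continuity of the transform. On the other hand mollification is
  symmetric, so that testing \<open>mollify r g\<close> with \<open>\<phi>\<close> is testing \<open>g\<close> with \<open>mollify r \<phi>\<close>, which converges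
  pointwise and boundedly to \<open>\<phi>\<close>. Thus the continuity of \<open>\<phi>\<close> replaces a theorem on the almost
  everywhere convergence of \<open>mollify r g\<close>.
\<close>

lemma fourier_inversion_integrable:
  fixes g :: "'a::euclidean_space \<Rightarrow> complex"
  assumes g: "g \<in> L2" and int: "integrable lborel g"
  shows "AE x in lborel. fourier (\<lambda>z. fourier_integral g (- z)) x = g x"
proof -
  have [measurable]: "g \<in> borel_measurable borel" using g by (simp add: L2_def)
  let ?G = "\<lambda>z. fourier_integral g (- z)"
  let ?r = "\<lambda>n. 1 / real (Suc n)"
  let ?Gn = "\<lambda>n z. ?G z * of_real (gauss (?r n) z)"
  have G: "?G \<in> L2" by (intro L2_reflect fourier_integral_L2 g int)
  have le: "cmod (?Gn n z) \<le> cmod (?G z)" for n z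
    by (simp add: norm_mult mult_left_le gauss_le_1)
  have Gn: "?Gn n \<in> L2" for n
    by (rule L2_dominated[OF G _ le]) measurable
  have Gn_int: "integrable lborel (?Gn n)" for n
    by (rule integrable_fourier_integral_gauss(2)[OF int]) simp
  have mollify: "AE x in lborel. fourier (?Gn n) x = mollify (?r n) g x" for n
    unfolding mollify_def by (rule fourier_eq_fourier_integral[OF Gn Gn_int])
  have "(\<lambda>n. energy (\<lambda>z. ?Gn n z - ?G z)) \<longlonglongrightarrow> 0"
  proof (rule energy_tendsto_0_dominated[OF _ G])
    show "(\<lambda>z. ?Gn n z - ?G z) \<in> borel_measurable borel" for n by measurable
    show "cmod (?Gn n z - ?G z) \<le> cmod (?G z)" for n z
    proof -
      have "?Gn n z - ?G z = ?G z * of_real (gauss (?r n) z - 1)" by (simp add: right_diff_distrib)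
      moreover have "\<bar>gauss (?r n) z - 1\<bar> \<le> 1"
        using gauss_le_1[of "?r n" z] gauss_nonneg[of "?r n" z] by linarith
      ultimately show ?thesis by (simp only: norm_mult norm_of_real) (simp add: mult_left_le)
    qed
    show "AE z in lborel. (\<lambda>n. ?Gn n z - ?G z) \<longlonglongrightarrow> 0"
    proof (rule AE_I2)
      fix z
      have "(\<lambda>n. ?Gn n z - ?G z) \<longlonglongrightarrow> ?G z * of_real (exp (- (0\<^sup>2 * (norm z)\<^sup>2 / 2))) - ?G z"
        unfolding gauss_def by (intro tendsto_intros LIMSEQ_Suc[OF lim_1_over_n]) auto
      then show "(\<lambda>n. ?Gn n z - ?G z) \<longlonglongrightarrow> 0" by simp
    qed
  qed
  from fourier_energy_continuous[OF Gn G this]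
  have lim: "(\<lambda>n. energy (\<lambda>x. fourier (?Gn n) x - fourier ?G x)) \<longlonglongrightarrow> 0" .
  have "AE x in lborel. fourier ?G x - g x = 0"
  proof (rule AE_zero_if_weakly_zero)
    show "(\<lambda>x. fourier ?G x - g x) \<in> L2" by (intro L2_diff fourier_L2 G g)
    fix \<phi> :: "'a \<Rightarrow> complex"
    assume cont: "continuous_on UNIV \<phi>" and \<phi>: "\<phi> \<in> L2" "integrable lborel \<phi>"
      and bound: "\<And>x. cmod (\<phi> x) \<le> 1"
    have [measurable]: "\<phi> \<in> borel_measurable borel" using \<phi> by (simp add: L2_def)
    have "(LINT x|lborel. \<phi> x * fourier (?Gn n) x)
        = (LINT x|lborel. g x * (LINT y|lborel. \<phi> y * of_real (heat_kernel (?r n) (y - x))))" for n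
    proof -
      have "(LINT x|lborel. \<phi> x * fourier (?Gn n) x) = (LINT x|lborel. \<phi> x * mollify (?r n) g x)"
      proof (rule integral_cong_AE)
        show "(\<lambda>x. \<phi> x * fourier (?Gn n) x) \<in> borel_measurable lborel"
          using fourier_L2[OF Gn[of n]] by (auto simp: L2_def)
        show "(\<lambda>x. \<phi> x * mollify (?r n) g x) \<in> borel_measurable lborel"
          unfolding mollify_def by measurable
      qed (use mollify[of n] in auto)
      also have "\<dots> = (LINT x|lborel. g x * mollify (?r n) \<phi> x)"
        by (rule mollify_symmetric[OF \<phi>(2) int]) simp
      finally show ?thesis by (simp add: mollify_eq_convolution[OF \<phi>(2)])
    qed
    then have "(\<lambda>n. LINT x|lborel. g x * (LINT y|lborel. \<phi> y * of_real (heat_kernel (?r n) (y - x))))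
        \<longlonglongrightarrow> (LINT x|lborel. \<phi> x * fourier ?G x)"
      using energy_tendsto_weakly[OF fourier_L2[OF Gn] fourier_L2[OF G] \<phi>(1) lim] by simp
    moreover have "(\<lambda>n. LINT x|lborel. g x * (LINT y|lborel. \<phi> y * of_real (heat_kernel (?r n) (y - x))))
        \<longlonglongrightarrow> (LINT x|lborel. g x * \<phi> x)"
    proof (rule integral_dominated_convergence[where w="\<lambda>x. cmod (g x)"])
      show "(\<lambda>x. g x * \<phi> x) \<in> borel_measurable lborel" by measurable
      show "(\<lambda>x. g x * (LINT y|lborel. \<phi> y * of_real (heat_kernel (?r n) (y - x)))) \<in> borel_measurable lborel" for n
        by measurable
      show "integrable lborel (\<lambda>x. cmod (g x))" using int by simp
      show "AE x in lborel. (\<lambda>n. g x * (LINT y|lborel. \<phi> y * of_real (heat_kernel (?r n) (y - x)))) \<longlonglongrightarrow> g x * \<phi> x"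
        by (intro AE_I2 tendsto_mult tendsto_const heat_kernel_approximate_identity[OF cont bound])
      show "AE x in lborel. norm (g x * (LINT y|lborel. \<phi> y * of_real (heat_kernel (?r n) (y - x)))) \<le> cmod (g x)" for n
        using cmod_heat_convolution_le[where \<phi>=\<phi> and B=1 and r="?r n"] bound
        by (intro AE_I2) (auto simp: norm_mult intro!: mult_left_le)
    qed
    ultimately have "(LINT x|lborel. \<phi> x * fourier ?G x) = (LINT x|lborel. g x * \<phi> x)"
      by (rule LIMSEQ_unique)
    then show "(LINT x|lborel. \<phi> x * (fourier ?G x - g x)) = 0"
      using integrable_L2_mult[OF \<phi>(1) fourier_L2[OF G]] integrable_L2_mult[OF \<phi>(1) g]
      by (simp add: right_diff_distrib mult.commute[of "g _"])
  qed
  then show ?thesis by simp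
qed

text \<open>
  Inversion passes from the integrable truncations to their limit by continuity of the transform.
\<close>

theorem fourier_inversion:
  fixes g :: "'a::euclidean_space \<Rightarrow> complex"
  assumes g: "g \<in> L2"
  shows "AE x in lborel. fourier (\<lambda>z. fourier g (- z)) x = g x"
proof -
  have [measurable]: "g \<in> borel_measurable borel" "fourier g \<in> borel_measurable borel"
    using g fourier_L2[OF g] by (auto simp: L2_def)
  let ?G = "\<lambda>z. fourier g (- z)"
  let ?Gn = "\<lambda>n z. fourier_integral (truncate n g) (- z)"
  have G: "?G \<in> L2" by (intro L2_reflect fourier_L2 g)
  have Gn: "?Gn n \<in> L2" for n
    by (intro L2_reflect fourier_integral_L2 truncate_integrable truncate_L2 g)
  have "energy (\<lambda>z. ?Gn n z - ?G z) = energy (\<lambda>z. fourier_integral (truncate n g) z - fourier g z)" for n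
    by (rule energy_reflect) measurable
  then have "(\<lambda>n. energy (\<lambda>z. ?Gn n z - ?G z)) \<longlonglongrightarrow> 0"
    using is_fourier_fourier[OF g] by (simp add: is_fourier_iff)
  from fourier_energy_continuous[OF Gn G this]
  have "(\<lambda>n. energy (\<lambda>x. fourier (?Gn n) x - fourier ?G x)) \<longlonglongrightarrow> 0" .
  moreover have "energy (\<lambda>x. fourier (?Gn n) x - fourier ?G x) = energy (\<lambda>x. truncate n g x - fourier ?G x)" for n
    using fourier_inversion_integrable[OF truncate_L2[OF g] truncate_integrable[OF g], of n]
    by (intro energy_cong_AE) auto
  ultimately have "(\<lambda>n. energy (\<lambda>x. truncate n g x - fourier ?G x)) \<longlonglongrightarrow> 0" by simp
  then show ?thesis
    using truncate_tendsto[OF g] fourier_L2[OF G]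
    by (intro energy_tendsto_unique[of "\<lambda>n. truncate n g"] truncate_measurable) (auto simp: L2_def)
qed

text \<open>
  Inversion makes the transform onto, so that the choice in \<^const>\<open>fourier_inv\<close> is never empty.
\<close>

lemma fourier_inv:
  assumes g: "g \<in> L2"
  shows "fourier_inv g \<in> L2" and "AE z in lborel. fourier (fourier_inv g) z = g z"
proof -
  have "\<exists>f. f \<in> L2 \<and> (AE z in lborel. fourier f z = g z)"
    using fourier_inversion[OF g] L2_reflect[OF fourier_L2[OF g]] by blast
  from someI_ex[OF this]
  show "fourier_inv g \<in> L2" and "AE z in lborel. fourier (fourier_inv g) z = g z"
    by (auto simp: fourier_inv_def)
qed

section \<open>The symbol of the equation\<close>

lemma x_exp_minus_le_1: "x * exp (- x) \<le> (1::real)"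
proof -
  have "x \<le> exp x" using exp_ge_add_one_self[of x] by linarith
  then show ?thesis by (simp add: exp_minus field_simps)
qed

text \<open>
  With \<open>u = T - t\<close> this is the decay of the integrand of \<^const>\<open>H\<close>: \<open>u exp (- u \<nu>)\<close> is at most \<open>T\<close>,
  and \<open>\<nu>\<close> times it is at most 1.
\<close>

lemma kernel_decay:
  fixes u \<nu> T :: real
  assumes "0 < u" "u \<le> T" "0 \<le> \<nu>"
  shows "(1 + \<nu>) * (exp (- u * \<nu>) * u) \<le> T + 1"
proof -
  have "u * exp (- u * \<nu>) \<le> T * 1"
    using assms by (intro mult_mono) auto
  moreover have "(u * \<nu>) * exp (- (u * \<nu>)) \<le> 1"
    by (rule x_exp_minus_le_1)
  ultimately show ?thesis by (simp add: algebra_simps)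
qed

lemma H_eq:
  "H T \<theta> \<nu> = (LINT t|lborel. of_real (exp (- (T - t) * \<nu>) * (T - t)) * (indicator {0<..<T} t *\<^sub>R \<theta> t))"
  unfolding H_def set_lebesgue_integral_def by (simp add: scaleR_conv_of_real mult_ac)

lemma L1_D: "\<theta> \<in> L1 T \<Longrightarrow> integrable lborel (\<lambda>t. indicator {0<..<T} t *\<^sub>R \<theta> t)"
  by (simp add: L1_def set_integrable_def)

lemma L1_diff: "\<theta> \<in> L1 T \<Longrightarrow> \<eta> \<in> L1 T \<Longrightarrow> (\<lambda>t. \<theta> t - \<eta> t) \<in> L1 T"
  unfolding L1_def by (auto intro: set_integral_diff(1))

lemma H_measurable:
  assumes "\<theta> \<in> L1 T"
  shows "H T \<theta> \<in> borel_measurable borel"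
proof -
  have [measurable]: "(\<lambda>t. indicator {0<..<T} t *\<^sub>R \<theta> t) \<in> borel_measurable borel"
    using L1_D[OF assms] by auto
  have "(\<lambda>\<nu>. LINT t|lborel. of_real (exp (- (T - t) * \<nu>) * (T - t)) * (indicator {0<..<T} t *\<^sub>R \<theta> t))
      \<in> borel_measurable borel"
    by (rule lborel.borel_measurable_lebesgue_integral) measurable
  then show ?thesis by (simp add: H_eq[abs_def])
qed

lemma H_integrand_bound:
  assumes "0 < T" "0 \<le> \<nu>"
  shows "(1 + \<nu>) * cmod (of_real (exp (- (T - t) * \<nu>) * (T - t)) * (indicator {0<..<T} t *\<^sub>R \<theta> t))
    \<le> (T + 1) * cmod (indicator {0<..<T} t *\<^sub>R \<theta> t)"
proof (cases "t \<in> {0<..<T}")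
  case True
  then have "(1 + \<nu>) * (exp (- (T - t) * \<nu>) * (T - t)) * cmod (\<theta> t) \<le> (T + 1) * cmod (\<theta> t)"
    using assms by (intro mult_right_mono kernel_decay) auto
  moreover have "cmod (of_real (exp (- (T - t) * \<nu>) * (T - t)) * (indicator {0<..<T} t *\<^sub>R \<theta> t))
      = (exp (- (T - t) * \<nu>) * (T - t)) * cmod (\<theta> t)"
    using True by (simp only: norm_mult norm_of_real) simp
  ultimately show ?thesis
    using True by (simp only: mult.assoc[symmetric]) simp
qed simp

lemma H_integrable:
  assumes \<theta>: "\<theta> \<in> L1 T" and T: "0 < T" and \<nu>: "0 \<le> \<nu>"
  shows "integrable lborel (\<lambda>t. of_real (exp (- (T - t) * \<nu>) * (T - t)) * (indicator {0<..<T} t *\<^sub>R \<theta> t))"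
    (is "integrable lborel ?f")
proof (rule Bochner_Integration.integrable_bound)
  have [measurable]: "(\<lambda>t. indicator {0<..<T} t *\<^sub>R \<theta> t) \<in> borel_measurable borel"
    using L1_D[OF \<theta>] by auto
  show "?f \<in> borel_measurable lborel" by measurable
  show "integrable lborel (\<lambda>t. (T + 1) *\<^sub>R (indicator {0<..<T} t *\<^sub>R \<theta> t))"
    using L1_D[OF \<theta>] by (rule integrable_scaleR_right)
  have "cmod (?f t) \<le> (1 + \<nu>) * cmod (?f t)" for t
    using mult_right_mono[of 1 "1 + \<nu>" "cmod (?f t)"] \<nu> by simp
  then have "cmod (?f t) \<le> (T + 1) * cmod (indicator {0<..<T} t *\<^sub>R \<theta> t)" for t
    using H_integrand_bound[OF T \<nu>, of t \<theta>] by (rule order_trans)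
  then show "AE t in lborel. norm (?f t) \<le> norm ((T + 1) *\<^sub>R (indicator {0<..<T} t *\<^sub>R \<theta> t))"
    using T by (intro AE_I2) (simp only: norm_scaleR, simp)
qed

lemma H_diff:
  assumes "\<theta> \<in> L1 T" "\<eta> \<in> L1 T" "0 < T" "0 \<le> \<nu>"
  shows "H T (\<lambda>t. \<theta> t - \<eta> t) \<nu> = H T \<theta> \<nu> - H T \<eta> \<nu>"
proof -
  let ?K = "\<lambda>t. complex_of_real (exp (- (T - t) * \<nu>) * (T - t))"
  have "?K t * (indicator {0<..<T} t *\<^sub>R (\<theta> t - \<eta> t))
      = ?K t * (indicator {0<..<T} t *\<^sub>R \<theta> t) - ?K t * (indicator {0<..<T} t *\<^sub>R \<eta> t)" for t
    by (simp only: scaleR_diff_right) (rule right_diff_distrib)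
  then show ?thesis
    unfolding H_eq using assms
    by (simp only: Bochner_Integration.integral_diff[OF H_integrable H_integrable])
qed

text \<open>
  The estimate carries both halves of the error analysis: it shows that \<open>H T \<theta>\<close> depends continuously
  on \<open>\<theta>\<close>, uniformly in \<open>\<nu>\<close>, and that \<open>H T \<theta> \<nu>\<close> can exceed a threshold only for \<open>\<nu>\<close> up to a multiple
  of its inverse.
\<close>

lemma H_decay:
  assumes \<theta>: "\<theta> \<in> L1 T" and T: "0 < T" and \<nu>: "0 \<le> \<nu>"
  shows "(1 + \<nu>) * cmod (H T \<theta> \<nu>) \<le> (T + 1) * L1_norm T \<theta>"
proof -
  let ?f = "\<lambda>t. of_real (exp (- (T - t) * \<nu>) * (T - t)) * (indicator {0<..<T} t *\<^sub>R \<theta> t)"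
  have "(1 + \<nu>) * cmod (H T \<theta> \<nu>) \<le> (1 + \<nu>) * (LINT t|lborel. cmod (?f t))"
    using \<nu> unfolding H_eq by (intro mult_left_mono integral_norm_bound) auto
  also have "\<dots> = (LINT t|lborel. (1 + \<nu>) * cmod (?f t))" by (simp only: integral_mult_right_zero)
  also have "\<dots> \<le> (LINT t|lborel. (T + 1) * cmod (indicator {0<..<T} t *\<^sub>R \<theta> t))"
    using H_integrable[OF \<theta> T \<nu>] L1_D[OF \<theta>]
    by (intro integral_mono H_integrand_bound T \<nu> integrable_mult_right integrable_norm)
  also have "\<dots> = (T + 1) * L1_norm T \<theta>"
    by (simp add: L1_norm_def set_lebesgue_integral_def)
  finally show ?thesis .
qed

lemma cmod_H_le:
  assumes "\<theta> \<in> L1 T" "0 < T" "0 \<le> \<nu>"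
  shows "cmod (H T \<theta> \<nu>) \<le> (T + 1) * L1_norm T \<theta>"
  using H_decay[OF assms] mult_right_mono[of 1 "1 + \<nu>" "cmod (H T \<theta> \<nu>)"] assms by simp

lemma L1_norm_nonneg: "0 \<le> L1_norm T \<theta>"
  unfolding L1_norm_def set_lebesgue_integral_def by (intro integral_nonneg_AE) auto

lemma L1_norm_le_add:
  assumes \<theta>: "\<theta> \<in> L1 T" and \<eta>: "\<eta> \<in> L1 T"
  shows "L1_norm T \<eta> \<le> L1_norm T \<theta> + L1_norm T (\<lambda>t. \<theta> t - \<eta> t)"
proof -
  note int = L1_D[OF \<theta>] L1_D[OF \<eta>] L1_D[OF L1_diff[OF \<theta> \<eta>]]
  have eq: "L1_norm T \<zeta> = (LINT t|lborel. cmod (indicator {0<..<T} t *\<^sub>R \<zeta> t))" for \<zeta>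
    by (simp add: L1_norm_def set_lebesgue_integral_def)
  have "L1_norm T \<eta> \<le> (LINT t|lborel. cmod (indicator {0<..<T} t *\<^sub>R \<theta> t)
      + cmod (indicator {0<..<T} t *\<^sub>R (\<theta> t - \<eta> t)))"
    unfolding eq
  proof (rule integral_mono)
    fix t
    show "cmod (indicator {0<..<T} t *\<^sub>R \<eta> t) \<le>
        cmod (indicator {0<..<T} t *\<^sub>R \<theta> t) + cmod (indicator {0<..<T} t *\<^sub>R (\<theta> t - \<eta> t))"
      using norm_triangle_ineq4[of "\<theta> t" "\<theta> t - \<eta> t"] by (auto simp: indicator_def)
  qed (intro Bochner_Integration.integrable_add integrable_norm int)+
  also have "\<dots> = L1_norm T \<theta> + L1_norm T (\<lambda>t. \<theta> t - \<eta> t)"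
    unfolding eq using int by (intro Bochner_Integration.integral_add integrable_norm)
  finally show ?thesis .
qed

section \<open>Sobolev norms as weighted energies\<close>

text \<open>
  The square root of the weight in the Sobolev norm, so that this norm squared is the energy of the
  weighted transform.
\<close>

definition sobolev_weight :: "real \<Rightarrow> 'a::euclidean_space \<Rightarrow> complex" where
  "sobolev_weight s z = of_real ((1 + (norm z)\<^sup>2) powr (s / 2))"

lemma sobolev_weight_measurable [measurable]: "sobolev_weight s \<in> borel_measurable borel"
  unfolding sobolev_weight_def by measurable

lemma cmod_sobolev_weight: "cmod (sobolev_weight s z) = (1 + (norm z)\<^sup>2) powr (s / 2)"
  by (simp add: sobolev_weight_def)

lemma sobolev_weight_ge_1: "0 \<le> s \<Longrightarrow> 1 \<le> cmod (sobolev_weight s z)"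
  by (simp add: cmod_sobolev_weight ge_one_powr_ge_zero)

lemma cmod_weighted_sq:
  "(cmod (sobolev_weight s z * w))\<^sup>2 = (1 + (norm z)\<^sup>2) powr s * (cmod w)\<^sup>2"
proof -
  have "((1 + (norm z)\<^sup>2) powr (s / 2))\<^sup>2 = (1 + (norm z)\<^sup>2) powr s"
    by (simp add: power2_eq_square powr_add[symmetric])
  then show ?thesis by (simp add: norm_mult cmod_sobolev_weight power_mult_distrib)
qed

lemma Sobolev_iff:
  "f \<in> Sobolev s \<longleftrightarrow> f \<in> L2 \<and> (\<lambda>z. sobolev_weight s z * fourier f z) \<in> L2"
proof -
  have "fourier f \<in> borel_measurable borel" if "f \<in> L2"
    using fourier_L2[OF that] by (simp add: L2_def)
  then show ?thesis
    unfolding Sobolev_def L2_def[of] by (auto simp: cmod_weighted_sq)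
qed

text \<open>
  Where the weighted energy is finite the function lies in the Sobolev space, so its norm is the
  square root of that energy and not the default value \<open>\<infinity>\<close>.
\<close>

lemma Sobolev_norm_tendsto_0:
  assumes L2: "\<forall>\<^sub>F \<epsilon> in F. u \<epsilon> \<in> L2"
    and lim: "((\<lambda>\<epsilon>. energy (\<lambda>z. sobolev_weight s z * fourier (u \<epsilon>) z)) \<longlongrightarrow> 0) F"
  shows "((\<lambda>\<epsilon>. Sobolev_norm s (u \<epsilon>)) \<longlongrightarrow> 0) F"
proof -
  let ?E = "\<lambda>\<epsilon>. energy (\<lambda>z. sobolev_weight s z * fourier (u \<epsilon>) z)"
  have "\<forall>\<^sub>F \<epsilon> in F. ?E \<epsilon> < 1"
    using lim by (rule order_tendstoD) simp
  with L2 have "\<forall>\<^sub>F \<epsilon> in F. ennreal (sqrt (enn2real (?E \<epsilon>))) = Sobolev_norm s (u \<epsilon>)"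
  proof eventually_elim
    case (elim \<epsilon>)
    then have m: "fourier (u \<epsilon>) \<in> borel_measurable borel"
      using fourier_L2 by (auto simp: L2_def)
    have w: "(\<lambda>z. sobolev_weight s z * fourier (u \<epsilon>) z) \<in> L2"
      using elim(2) m order_less_trans[OF elim(2) ennreal_one_less_top] by (auto simp: L2_iff_energy)
    then have S: "u \<epsilon> \<in> Sobolev s" using elim(1) by (simp add: Sobolev_iff)
    show ?case
      using S by (simp add: Sobolev_norm_def energy_eq_integral[OF w] cmod_weighted_sq)
  qed
  moreover have "((\<lambda>\<epsilon>. enn2real (?E \<epsilon>)) \<longlongrightarrow> 0) F"
    by (rule tendsto_enn2real) (use lim in simp_all)
  then have "((\<lambda>\<epsilon>. ennreal (sqrt (enn2real (?E \<epsilon>)))) \<longlongrightarrow> ennreal (sqrt 0)) F"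
    by (intro tendsto_ennrealI tendsto_real_sqrt)
  ultimately show ?thesis
    using Lim_transform_eventually[of "\<lambda>\<epsilon>. ennreal (sqrt (enn2real (?E \<epsilon>)))"] by simp
qed

section \<open>Error of the regularized solution\<close>

lemma energy_le_scaled:
  assumes [measurable]: "g \<in> borel_measurable borel"
    and le: "\<And>x. cmod (f x) \<le> c * cmod (g x)"
  shows "energy f \<le> ennreal (c\<^sup>2) * energy g"
proof -
  have "energy f \<le> (\<integral>\<^sup>+ x. ennreal (c\<^sup>2) * ennreal ((cmod (g x))\<^sup>2) \<partial>lborel)"
    unfolding energy_def
  proof (rule nn_integral_mono)
    fix x
    have "(cmod (f x))\<^sup>2 \<le> (c * cmod (g x))\<^sup>2" using le by (intro power_mono) auto
    then show "ennreal ((cmod (f x))\<^sup>2) \<le> ennreal (c\<^sup>2) * ennreal ((cmod (g x))\<^sup>2)"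
      by (simp add: ennreal_mult[symmetric] power_mult_distrib ennreal_leI)
  qed
  then show ?thesis by (simp add: energy_def nn_integral_cmult)
qed

text \<open>
  The sets where \<open>q \<le> \<delta>\<close> shrink to a null set as \<open>\<delta>\<close> tends to 0, so dominated convergence
  applies along \<open>\<delta> = 1 / (n + 1)\<close>, and monotonicity in \<open>\<delta>\<close> passes to an arbitrary filter.
\<close>

lemma energy_restrict_small_tendsto_0:
  fixes q :: "'a::euclidean_space \<Rightarrow> real"
  assumes u: "u \<in> L2" and q: "q \<in> borel_measurable borel" "AE z in lborel. 0 < q z"
    and \<delta>: "(\<delta> \<longlongrightarrow> 0) F"
  shows "((\<lambda>\<epsilon>. energy (\<lambda>z. if q z \<le> \<delta> \<epsilon> then u z else 0)) \<longlongrightarrow> 0) F"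
proof (rule order_tendstoI)
  have [measurable]: "u \<in> borel_measurable borel" "q \<in> borel_measurable borel"
    using u q by (auto simp: L2_def)
  have lim: "(\<lambda>n. energy (\<lambda>z. if q z \<le> 1 / real (Suc n) then u z else 0)) \<longlonglongrightarrow> 0"
  proof (rule energy_tendsto_0_dominated[OF _ u])
    show "AE z in lborel. (\<lambda>n. if q z \<le> 1 / real (Suc n) then u z else 0) \<longlonglongrightarrow> 0"
      using q(2)
    proof eventually_elim
      case (elim z)
      have "\<forall>\<^sub>F n in sequentially. 1 / real (Suc n) < q z"
        by (rule order_tendstoD(2)[OF LIMSEQ_Suc[OF lim_1_over_n] elim])
      then show ?case by (intro tendsto_eventually, elim eventually_mono) auto
    qed
  qed auto
  fix e :: ennreal assume "0 < e"
  then obtain n where n: "energy (\<lambda>z. if q z \<le> 1 / real (Suc n) then u z else 0) < e"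
    using order_tendstoD(2)[OF lim] by (auto simp: eventually_sequentially)
  have "\<forall>\<^sub>F \<epsilon> in F. \<delta> \<epsilon> < 1 / real (Suc n)"
    by (rule order_tendstoD[OF \<delta>]) simp
  then show "\<forall>\<^sub>F \<epsilon> in F. energy (\<lambda>z. if q z \<le> \<delta> \<epsilon> then u z else 0) < e"
  proof eventually_elim
    case (elim \<epsilon>)
    have "energy (\<lambda>z. if q z \<le> \<delta> \<epsilon> then u z else 0)
        \<le> energy (\<lambda>z. if q z \<le> 1 / real (Suc n) then u z else 0)"
      using elim by (intro energy_mono) auto
    then show ?case using n by (rule order_le_less_trans)
  qed
qed simp

lemma symbol_measurable:
  assumes "\<theta> \<in> L1 T"
  shows "(\<lambda>z::'a::euclidean_space. H T \<theta> (norm z powr (2 * \<sigma>))) \<in> borel_measurable borel"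
  by (rule measurable_compose[OF _ H_measurable[OF assms]]) measurable

text \<open>
  If the symbol vanished on a set of positive measure, a nonzero function with Fourier transform
  supported there could be added to \<open>f\<close> without changing the equation.
\<close>

lemma unique_solution_symbol_nonzero:
  fixes f h :: "'a::euclidean_space \<Rightarrow> complex"
  assumes "s \<ge> 0" and \<psi>: "\<psi> \<in> L1 T" and f: "f \<in> Sobolev s" and sol: "is_solution T \<sigma> \<psi> h f"
    and unique: "\<And>g. g \<in> Sobolev s \<Longrightarrow> is_solution T \<sigma> \<psi> h g \<Longrightarrow> (AE x in lborel. g x = f x)"
  shows "AE z in lborel. H T \<psi> (norm (z::'a) powr (2 * \<sigma>)) \<noteq> 0"
proof -
  let ?H = "\<lambda>z::'a. H T \<psi> (norm z powr (2 * \<sigma>))"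
  have [measurable]: "?H \<in> borel_measurable borel" by (rule symbol_measurable[OF \<psi>])
  let ?v0 = "\<lambda>z::'a. if ?H z = 0 then of_real (gauss 1 z) else (0 :: complex)"
  \<comment> \<open>A function that is supported on the zeros of the symbol and positive there; dividing by the
    weight puts it into the weighted space.\<close>
  define v where "v z = ?v0 z / sobolev_weight s z" for z
  have W: "sobolev_weight s z \<noteq> 0" for z :: 'a
    using sobolev_weight_ge_1[OF \<open>s \<ge> 0\<close>, of z] by auto
  have v0: "?v0 \<in> L2"
    by (rule L2_dominated[OF gauss_L2[of 1]]) auto
  have v: "v \<in> L2"
  proof (rule L2_dominated[OF v0])
    show "v \<in> borel_measurable borel" unfolding v_def by measurable
    show "cmod (v z) \<le> cmod (?v0 z)" for z
      using divide_left_mono[OF sobolev_weight_ge_1[OF \<open>s \<ge> 0\<close>, of z], of "cmod (?v0 z)"] W[of z]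
      by (simp only: v_def norm_divide) simp
  qed
  \<comment> \<open>The competitor \<open>f - k\<close> solves the same equation.\<close>
  define k where "k = fourier_inv v"
  have k: "k \<in> L2" "AE z in lborel. fourier k z = v z"
    unfolding k_def by (rule fourier_inv[OF v])+
  define g where "g = (\<lambda>x. f x - k x)"
  have fL2: "f \<in> L2" and wf: "(\<lambda>z. sobolev_weight s z * fourier f z) \<in> L2"
    using f by (auto simp: Sobolev_iff)
  have gL2: "g \<in> L2" unfolding g_def by (rule L2_diff[OF fL2 k(1)])
  have Fg: "AE z in lborel. fourier g z = fourier f z - v z"
    using fourier_diff[OF fL2 k(1)] k(2) unfolding g_def by eventually_elim simp
  have "g \<in> Sobolev s"
    unfolding Sobolev_iff
  proof
    have "energy (\<lambda>z. sobolev_weight s z * fourier g z)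
        = energy (\<lambda>z. sobolev_weight s z * fourier f z - ?v0 z)"
      using Fg by (intro energy_cong_AE) (auto simp: v_def W right_diff_distrib)
    also have "\<dots> < \<infinity>" using L2_diff[OF wf v0] by (simp add: L2_iff_energy)
    finally show "(\<lambda>z. sobolev_weight s z * fourier g z) \<in> L2"
      using fourier_L2[OF gL2] by (auto simp: L2_iff_energy)
  qed (rule gL2)
  moreover have "is_solution T \<sigma> \<psi> h g"
    using sol Fg unfolding is_solution_def by eventually_elim (auto simp: v_def right_diff_distrib)
  ultimately have "AE x in lborel. g x = f x" by (rule unique)
  then have "AE x in lborel. k x = 0" by (simp add: g_def)
  then have "energy k = 0" using k(1) by (subst energy_eq_0_iff) (auto simp: L2_def)
  then have "energy (fourier k) = 0" using fourier_energy_le[OF k(1)] by simp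
  then have "AE z in lborel. fourier k z = 0"
    using fourier_L2[OF k(1)] by (subst (asm) energy_eq_0_iff) (auto simp: L2_def)
  with k(2) show ?thesis
  proof eventually_elim
    case (elim z)
    then have "?v0 z = 0" using W[of z] by (simp add: v_def)
    then show ?case using gauss_pos[of 1 z] by (auto simp del: gauss_pos)
  qed
qed

text \<open>
  Since \<open>\<nu> = \<bar>z\<bar> powr (2 * \<sigma>)\<close>, both 1 and \<open>\<bar>z\<bar>\<^sup>2\<close> are at most \<open>(1 + \<nu>) powr (1 / \<sigma>)\<close>.
\<close>

lemma sobolev_weight_le:
  fixes z :: "'a::euclidean_space"
  assumes "0 < \<sigma>" "0 \<le> s"
  shows "cmod (sobolev_weight s z) \<le> 2 powr (s / 2) * (1 + norm z powr (2 * \<sigma>)) powr (s / (2 * \<sigma>))"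
proof -
  let ?b = "(1 + norm z powr (2 * \<sigma>)) powr (1 / \<sigma>)"
  have "1 \<le> ?b" using assms by (intro ge_one_powr_ge_zero) auto
  moreover have "(norm z)\<^sup>2 \<le> ?b"
  proof (cases "z = 0")
    case False
    then have "(norm z)\<^sup>2 = (norm z powr (2 * \<sigma>)) powr (1 / \<sigma>)"
      using assms by (simp add: powr_powr)
    also have "\<dots> \<le> ?b" using assms by (intro powr_mono2) auto
    finally show ?thesis .
  qed simp
  ultimately have "1 + (norm z)\<^sup>2 \<le> 2 * ?b" by simp
  then have "(1 + (norm z)\<^sup>2) powr (s / 2) \<le> (2 * ?b) powr (s / 2)"
    using assms by (intro powr_mono2) auto
  also have "\<dots> = 2 powr (s / 2) * (1 + norm z powr (2 * \<sigma>)) powr (s / (2 * \<sigma>))"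
    by (simp add: powr_mult powr_powr mult.commute)
  finally show ?thesis by (simp add: cmod_sobolev_weight)
qed

text \<open>
  The three terms of the bound belong to the three sources of error: the frequencies where the
  perturbed symbol is below the threshold \<open>a\<close>, the perturbation of the symbol, and the perturbation
  of \<open>h\<close>. On the retained frequencies division by the symbol costs a factor \<open>1 / a\<close>; there
  \<open>1 + \<bar>z\<bar> powr (2 * \<sigma>)\<close> is at most a constant over \<open>a\<close> by the decay of the symbol, so the Sobolev weight costs at most a constant times
  \<open>a powr (- s / (2 * \<sigma>))\<close>. Together these factors explain the quantity \<open>q\<close>.
\<close>

lemma regularization_error:
  fixes f h h' :: "'a::euclidean_space \<Rightarrow> complex"
  assumes T: "0 < T" and \<sigma>: "0 < \<sigma>" and s: "0 \<le> s"
    and \<psi>: "\<psi> \<in> L1 T" "\<psi>' \<in> L1 T" and h: "h \<in> L2" "h' \<in> L2"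
    and noise: "L2_norm (\<lambda>x. h x - h' x) + L1_norm T (\<lambda>t. \<psi> t - \<psi>' t) \<le> \<epsilon>"
    and \<epsilon>: "0 < \<epsilon>" "\<epsilon> \<le> 1" and a: "0 < a" "a \<le> 1"
    and f: "f \<in> Sobolev s" and sol: "is_solution T \<sigma> \<psi> h f"
  defines "q \<equiv> \<epsilon> / a powr (1 + s / (2 * \<sigma>))"
    and "C \<equiv> 2 powr (s / 2) * ((T + 1) * (L1_norm T \<psi> + 1)) powr (s / (2 * \<sigma>))"
    and "u \<equiv> (\<lambda>z. sobolev_weight s z * fourier f z)"
  shows "(\<lambda>x. f x - regularized T \<sigma> a \<psi>' h' x) \<in> L2"
    and "energy (\<lambda>z. sobolev_weight s z * fourier (\<lambda>x. f x - regularized T \<sigma> a \<psi>' h' x) z)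
      \<le> 2 * energy (\<lambda>z. if cmod (H T \<psi> (norm z powr (2 * \<sigma>))) \<le> a + (T + 1) * \<epsilon> then u z else 0)
        + 2 * (2 * (ennreal (((T + 1) * q)\<^sup>2) * energy u) + 2 * ennreal (2 * (C * q)\<^sup>2))"
proof -
  let ?H = "\<lambda>z::'a. H T \<psi> (norm z powr (2 * \<sigma>))" and ?H' = "\<lambda>z::'a. H T \<psi>' (norm z powr (2 * \<sigma>))"
  let ?p = "s / (2 * \<sigma>)"
  define M where "M = (T + 1) * (L1_norm T \<psi> + 1)"
  have M: "0 < M" using T L1_norm_nonneg[of T \<psi>] by (simp add: M_def)
  have fL2: "f \<in> L2" and uL2: "u \<in> L2" using f by (auto simp: Sobolev_iff u_def)
  have [measurable]: "?H \<in> borel_measurable borel" "?H' \<in> borel_measurable borel"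
    "fourier f \<in> borel_measurable borel" "fourier h \<in> borel_measurable borel"
    "fourier h' \<in> borel_measurable borel" "u \<in> borel_measurable borel"
    using \<psi> fourier_L2[OF fL2] fourier_L2[OF h(1)] fourier_L2[OF h(2)] uL2
    by (auto simp: symbol_measurable L2_def)
  have "0 \<le> L2_norm (\<lambda>x. h x - h' x)" by (simp add: L2_norm_def)
  then have noise1: "L1_norm T (\<lambda>t. \<psi> t - \<psi>' t) \<le> \<epsilon>" and noise2: "L2_norm (\<lambda>x. h x - h' x) \<le> \<epsilon>"
    using noise L1_norm_nonneg[of T "\<lambda>t. \<psi> t - \<psi>' t"] by linarith+
  have dH: "cmod (?H z - ?H' z) \<le> (T + 1) * \<epsilon>" for z
  proof -
    have "cmod (?H z - ?H' z) \<le> (T + 1) * L1_norm T (\<lambda>t. \<psi> t - \<psi>' t)"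
      using cmod_H_le[OF L1_diff[OF \<psi>] T, of "norm z powr (2 * \<sigma>)"] H_diff[OF \<psi> T, of "norm z powr (2 * \<sigma>)"]
      by simp
    also have "\<dots> \<le> (T + 1) * \<epsilon>" using noise1 T by (intro mult_left_mono) auto
    finally show ?thesis .
  qed
  have weight: "cmod (sobolev_weight s z) \<le> C / a powr ?p" if "a < cmod (?H' z)" for z
  proof -
    let ?\<nu> = "norm z powr (2 * \<sigma>)"
    have "(1 + ?\<nu>) * a \<le> (1 + ?\<nu>) * cmod (?H' z)" using that by (intro mult_left_mono) auto
    also have "\<dots> \<le> (T + 1) * L1_norm T \<psi>'" by (rule H_decay[OF \<psi>(2) T]) simp
    also have "\<dots> \<le> M"
      unfolding M_def using L1_norm_le_add[OF \<psi>] noise1 \<epsilon>(2) T by (intro mult_left_mono) auto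
    finally have "1 + ?\<nu> \<le> M / a" using a by (simp add: pos_le_divide_eq)
    then have "(1 + ?\<nu>) powr ?p \<le> (M / a) powr ?p"
      using s \<sigma> by (intro powr_mono2) (auto intro: add_nonneg_nonneg)
    also have "\<dots> = M powr ?p / a powr ?p" using M a by (simp add: powr_divide)
    finally have "2 powr (s / 2) * (1 + ?\<nu>) powr ?p \<le> 2 powr (s / 2) * (M powr ?p / a powr ?p)"
      by (intro mult_left_mono) auto
    then show ?thesis
      using sobolev_weight_le[OF \<sigma> s, of z] by (simp add: C_def M_def)
  qed
  \<comment> \<open>The first inequality holds since \<open>a \<le> 1\<close>: the perturbation of the symbol is less harmful than
    that of \<open>h\<close>, because \<open>f\<close> already lies in the weighted space.\<close>
  have q: "\<epsilon> / a \<le> q" "C / a powr ?p * (1 / a) * \<epsilon> = C * q" "0 \<le> q"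
  proof -
    have "a powr (1 + ?p) \<le> a powr 1" using a s \<sigma> by (intro powr_mono') auto
    then show "\<epsilon> / a \<le> q" unfolding q_def using a \<epsilon> by (intro divide_left_mono) auto
    show "C / a powr ?p * (1 / a) * \<epsilon> = C * q" using a by (simp add: q_def powr_add)
    show "0 \<le> q" using \<epsilon> by (simp add: q_def)
  qed

  define G where "G z = (if cmod (?H' z) > a then fourier h' z / ?H' z else 0)" for z
  have "(\<lambda>z. fourier h' z / of_real a) \<in> L2"
    using fourier_L2[OF h(2)] by (simp add: L2_def norm_divide power_divide)
  then have G: "G \<in> L2"
  proof (rule L2_dominated)
    show "G \<in> borel_measurable borel" unfolding G_def by measurable
    show "cmod (G z) \<le> cmod (fourier h' z / of_real a)" for z
      using a by (auto simp: G_def norm_divide intro!: divide_left_mono mult_pos_pos)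
  qed
  have reg: "regularized T \<sigma> a \<psi>' h' = fourier_inv G"
    by (simp add: regularized_def G_def[abs_def])
  have R: "regularized T \<sigma> a \<psi>' h' \<in> L2" "AE z in lborel. fourier (regularized T \<sigma> a \<psi>' h') z = G z"
    unfolding reg by (rule fourier_inv[OF G])+
  show "(\<lambda>x. f x - regularized T \<sigma> a \<psi>' h' x) \<in> L2" by (rule L2_diff[OF fL2 R(1)])

  let ?P = "\<lambda>z. cmod (?H' z) > a"
  \<comment> \<open>On the retained frequencies, with \<open>H f^ = h^\<close>, the error \<open>f^ - h'^ / H'\<close> equals
    \<open>(f^ (H' - H) + (h^ - h'^)) / H'\<close>.\<close>
  define A where "A z = (if ?P z then 0 else u z)" for z
  define B where "B z = (if ?P z then u z * (?H' z - ?H z) / ?H' z else 0)" for z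
  define D where "D z = (if ?P z then sobolev_weight s z * (fourier h z - fourier h' z) / ?H' z else 0)" for z
  have [measurable]: "A \<in> borel_measurable borel" "B \<in> borel_measurable borel" "D \<in> borel_measurable borel"
    unfolding A_def B_def D_def by measurable
  have "AE z in lborel. sobolev_weight s z * fourier (\<lambda>x. f x - regularized T \<sigma> a \<psi>' h' x) z = A z + (B z + D z)"
    using fourier_diff[OF fL2 R(1)] R(2) sol[unfolded is_solution_def]
  proof eventually_elim
    case (elim z)
    show ?case
    proof (cases "?P z")
      case True
      then have "?H' z \<noteq> 0" using a by auto
      then have "fourier f z - fourier h' z / ?H' z
          = fourier f z * (?H' z - ?H z) / ?H' z + (fourier h z - fourier h' z) / ?H' z"
        by (simp add: elim(3)[symmetric] field_simps)
      from arg_cong[OF this, of "\<lambda>w. sobolev_weight s z * w"] show ?thesis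
        using True by (simp add: elim(1,2) A_def B_def D_def G_def u_def distrib_left mult.assoc)
    qed (simp add: elim(1,2) A_def B_def D_def G_def u_def)
  qed
  then have "energy (\<lambda>z. sobolev_weight s z * fourier (\<lambda>x. f x - regularized T \<sigma> a \<psi>' h' x) z)
      = energy (\<lambda>z. A z + (B z + D z))"
    by (rule energy_cong_AE)
  also have "\<dots> \<le> 2 * energy A + 2 * energy (\<lambda>z. B z + D z)"
    by (rule energy_add_le) measurable
  also have "\<dots> \<le> 2 * energy A + 2 * (2 * energy B + 2 * energy D)"
    by (intro add_left_mono mult_left_mono energy_add_le) auto
  also have "\<dots> \<le> 2 * energy (\<lambda>z. if cmod (?H z) \<le> a + (T + 1) * \<epsilon> then u z else 0)
        + 2 * (2 * (ennreal (((T + 1) * q)\<^sup>2) * energy u) + 2 * ennreal (2 * (C * q)\<^sup>2))"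
  proof (intro add_mono mult_left_mono)
    show "energy A \<le> energy (\<lambda>z. if cmod (?H z) \<le> a + (T + 1) * \<epsilon> then u z else 0)"
    proof (rule energy_mono)
      fix z
      have "cmod (?H z) \<le> a + (T + 1) * \<epsilon>" if "\<not> ?P z"
        using norm_triangle_sub[of "?H z" "?H' z"] dH[of z] that by linarith
      then show "cmod (A z) \<le> cmod (if cmod (?H z) \<le> a + (T + 1) * \<epsilon> then u z else 0)"
        by (auto simp: A_def)
    qed
    show "energy B \<le> ennreal (((T + 1) * q)\<^sup>2) * energy u"
    proof (rule energy_le_scaled)
      fix z
      show "cmod (B z) \<le> (T + 1) * q * cmod (u z)"
      proof (cases "?P z")
        case True
        have "cmod (?H' z - ?H z) / cmod (?H' z) \<le> (T + 1) * \<epsilon> / a"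
          using dH[of z] True a T \<epsilon> by (intro frac_le) (auto simp: norm_minus_commute)
        also have "\<dots> \<le> (T + 1) * q" using mult_left_mono[OF q(1), of "T + 1"] T by simp
        finally have "cmod (u z) * (cmod (?H' z - ?H z) / cmod (?H' z)) \<le> cmod (u z) * ((T + 1) * q)"
          by (rule mult_left_mono) simp
        then show ?thesis using True by (simp add: B_def norm_mult norm_divide mult_ac)
      qed (use T q in \<open>simp add: B_def\<close>)
    qed measurable
    have "energy D \<le> ennreal ((C / a powr ?p * (1 / a))\<^sup>2) * energy (\<lambda>z. fourier h z - fourier h' z)"
    proof (rule energy_le_scaled)
      fix z
      have C: "0 \<le> C" by (simp add: C_def)
      show "cmod (D z) \<le> C / a powr ?p * (1 / a) * cmod (fourier h z - fourier h' z)"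
      proof (cases "?P z")
        case True
        have "1 / cmod (?H' z) \<le> 1 / a" using True a by (intro divide_left_mono mult_pos_pos) auto
        then have "cmod (sobolev_weight s z) * (1 / cmod (?H' z)) \<le> C / a powr ?p * (1 / a)"
          using weight[OF True] C by (intro mult_mono) auto
        from mult_right_mono[OF this norm_ge_zero[of "fourier h z - fourier h' z"]]
        show ?thesis using True by (simp add: D_def norm_mult norm_divide mult_ac)
      qed (use C a in \<open>simp add: D_def\<close>)
    qed measurable
    also have "energy (\<lambda>z. fourier h z - fourier h' z) = energy (fourier (\<lambda>x. h x - h' x))"
      using fourier_diff[OF h] by (intro energy_cong_AE) auto
    also have "\<dots> \<le> 2 * energy (\<lambda>x. h x - h' x)" by (rule fourier_energy_le[OF L2_diff[OF h]])
    also have "\<dots> \<le> 2 * ennreal (\<epsilon>\<^sup>2)"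
      unfolding energy_eq_L2_norm[OF L2_diff[OF h]]
      using noise2 by (intro mult_left_mono ennreal_leI power_mono) (auto simp: L2_norm_def)
    also have "ennreal ((C / a powr ?p * (1 / a))\<^sup>2) * (2 * ennreal (\<epsilon>\<^sup>2)) = ennreal (2 * (C * q)\<^sup>2)"
      unfolding q(2)[symmetric] power_mult_distrib[of _ \<epsilon>]
      by (simp add: ennreal_mult mult_ac)
    finally show "energy D \<le> ennreal (2 * (C * q)\<^sup>2)"
      by (simp add: mult_left_mono)
  qed auto
  finally show "energy (\<lambda>z. sobolev_weight s z * fourier (\<lambda>x. f x - regularized T \<sigma> a \<psi>' h' x) z)
      \<le> 2 * energy (\<lambda>z. if cmod (H T \<psi> (norm z powr (2 * \<sigma>))) \<le> a + (T + 1) * \<epsilon> then u z else 0)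
        + 2 * (2 * (ennreal (((T + 1) * q)\<^sup>2) * energy u) + 2 * ennreal (2 * (C * q)\<^sup>2))" .
qed

theorem theorem4p1:
  fixes T \<sigma> s :: real
    and \<psi> :: "real \<Rightarrow> complex"
    and h f :: "real ^ 'n::finite \<Rightarrow> complex"
    and \<psi>' :: "real \<Rightarrow> real \<Rightarrow> complex"
    and h' :: "real \<Rightarrow> real ^ 'n \<Rightarrow> complex"
    and \<alpha> :: "real \<Rightarrow> real"
  assumes "T > 0" and "0 < \<sigma>" and "\<sigma> \<le> 1" and "s \<ge> 0"
    and "\<psi> \<in> L1 T" and "\<not> (AE t\<in>{0<..<T} in lborel. \<psi> t = 0)"
    and "h \<in> L2"
    and "\<And>\<epsilon>. \<epsilon> > 0 \<Longrightarrow> \<psi>' \<epsilon> \<in> L1 T"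
    and "\<And>\<epsilon>. \<epsilon> > 0 \<Longrightarrow> h' \<epsilon> \<in> L2"
    and "\<And>\<epsilon>. \<epsilon> > 0 \<Longrightarrow>
           L2_norm (\<lambda>x. h x - h' \<epsilon> x) + L1_norm T (\<lambda>t. \<psi> t - \<psi>' \<epsilon> t) \<le> \<epsilon>"
    and "f \<in> Sobolev s" and "is_solution T \<sigma> \<psi> h f"
    and "\<And>g. g \<in> Sobolev s \<Longrightarrow> is_solution T \<sigma> \<psi> h g \<Longrightarrow> (AE x in lborel. g x = f x)"
    and "\<And>\<epsilon>. \<epsilon> > 0 \<Longrightarrow> \<alpha> \<epsilon> > 0"
    and "(\<alpha> \<longlongrightarrow> 0) (at_right 0)"
    and "((\<lambda>\<epsilon>. \<epsilon> / \<alpha> \<epsilon> powr (1 + s / (2 * \<sigma>))) \<longlongrightarrow> 0) (at_right 0)"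
  shows "((\<lambda>\<epsilon>. Sobolev_norm s (\<lambda>x. f x - regularized T \<sigma> (\<alpha> \<epsilon>) (\<psi>' \<epsilon>) (h' \<epsilon>) x))
           \<longlongrightarrow> 0) (at_right 0)"
proof (rule Sobolev_norm_tendsto_0)
  let ?u = "\<lambda>z. sobolev_weight s z * fourier f z"
  let ?q = "\<lambda>\<epsilon>. \<epsilon> / \<alpha> \<epsilon> powr (1 + s / (2 * \<sigma>))"
  let ?C = "2 powr (s / 2) * ((T + 1) * (L1_norm T \<psi> + 1)) powr (s / (2 * \<sigma>))"
  let ?R = "\<lambda>\<epsilon> x. f x - regularized T \<sigma> (\<alpha> \<epsilon>) (\<psi>' \<epsilon>) (h' \<epsilon>) x"
  let ?A = "\<lambda>\<epsilon>. energy (\<lambda>z. if cmod (H T \<psi> (norm z powr (2 * \<sigma>))) \<le> \<alpha> \<epsilon> + (T + 1) * \<epsilon> then ?u z else 0)"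
  let ?bound = "\<lambda>\<epsilon>. 2 * ?A \<epsilon> + 2 * (2 * (ennreal (((T + 1) * ?q \<epsilon>)\<^sup>2) * energy ?u) + 2 * ennreal (2 * (?C * ?q \<epsilon>)\<^sup>2))"
  have u: "?u \<in> L2" using assms(11) by (simp add: Sobolev_iff)
  have "\<forall>\<^sub>F \<epsilon> in at_right 0. \<alpha> \<epsilon> < 1" by (rule order_tendstoD[OF assms(15)]) simp
  moreover have "\<forall>\<^sub>F \<epsilon> in at_right (0::real). \<epsilon> < 1"
    by (rule order_tendstoD[OF tendsto_ident_at]) simp
  moreover have "\<forall>\<^sub>F \<epsilon> in at_right (0::real). 0 < \<epsilon>" by (rule eventually_at_right_less)
  ultimately have ev: "\<forall>\<^sub>F \<epsilon> in at_right 0. 0 < \<epsilon> \<and> \<epsilon> \<le> 1 \<and> 0 < \<alpha> \<epsilon> \<and> \<alpha> \<epsilon> \<le> 1"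
    by eventually_elim (use assms(14) in auto)
  show "\<forall>\<^sub>F \<epsilon> in at_right 0. ?R \<epsilon> \<in> L2"
    using ev
  proof eventually_elim
    case (elim \<epsilon>)
    then show ?case
      using regularization_error(1)[OF assms(1,2,4,5) assms(8) assms(7) assms(9) assms(10)] assms(11,12) by blast
  qed
  have le: "\<forall>\<^sub>F \<epsilon> in at_right 0. energy (\<lambda>z. sobolev_weight s z * fourier (?R \<epsilon>) z) \<le> ?bound \<epsilon>"
    using ev
  proof eventually_elim
    case (elim \<epsilon>)
    then show ?case
      using regularization_error(2)[OF assms(1,2,4,5) assms(8) assms(7) assms(9) assms(10), of \<epsilon> "\<alpha> \<epsilon>" f] assms(11,12) by blast
  qed
  have A: "(?A \<longlongrightarrow> 0) (at_right 0)"
  proof (rule energy_restrict_small_tendsto_0[OF u])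
    show "(\<lambda>z::real^'n. cmod (H T \<psi> (norm z powr (2 * \<sigma>)))) \<in> borel_measurable borel"
      by (intro measurable_compose[OF symbol_measurable[OF assms(5)]]) auto
    have "AE z::real^'n in lborel. H T \<psi> (norm z powr (2 * \<sigma>)) \<noteq> 0"
      by (rule unique_solution_symbol_nonzero[OF assms(4,5,11,12)]) (rule assms(13))
    then show "AE z::real^'n in lborel. 0 < cmod (H T \<psi> (norm z powr (2 * \<sigma>)))"
      by eventually_elim simp
    have "((\<lambda>\<epsilon>. \<alpha> \<epsilon> + (T + 1) * \<epsilon>) \<longlongrightarrow> 0 + (T + 1) * 0) (at_right 0)"
      by (intro tendsto_intros assms(15))
    then show "((\<lambda>\<epsilon>. \<alpha> \<epsilon> + (T + 1) * \<epsilon>) \<longlongrightarrow> 0) (at_right 0)" by simp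
  qed
  have sq: "((\<lambda>\<epsilon>. ennreal (c * (d * ?q \<epsilon>)\<^sup>2)) \<longlongrightarrow> 0) (at_right 0)" for c d
  proof -
    have "((\<lambda>\<epsilon>. ennreal (c * (d * ?q \<epsilon>)\<^sup>2)) \<longlongrightarrow> ennreal (c * (d * 0)\<^sup>2)) (at_right 0)"
      by (intro tendsto_ennrealI tendsto_intros assms(16))
    then show ?thesis by simp
  qed
  have fin: "energy ?u < top" using u by (simp add: L2_iff_energy)
  have "(?bound \<longlongrightarrow> 2 * 0 + 2 * (2 * (0 * energy ?u) + 2 * 0)) (at_right 0)"
    using sq[of 1 "T + 1"] sq[of 2 ?C] A fin
    by (intro tendsto_add ennreal_tendsto_cmult tendsto_mult_ennreal tendsto_const) auto
  then have bound: "(?bound \<longlongrightarrow> 0) (at_right 0)" by simp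
  show "((\<lambda>\<epsilon>. energy (\<lambda>z. sobolev_weight s z * fourier (?R \<epsilon>) z)) \<longlongrightarrow> 0) (at_right 0)"
    by (rule tendsto_sandwich[OF _ le tendsto_const bound]) simp
qed

end
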